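(* Let $T\subset\mathbb{R}^2$ be a convex polygon with $n$ vertices, with generalized barycentric coordinates $\lambda_1,\dots,\lambda_n$ and spaces $\mathcal{M}\Lambda^0(T)$ and $\chi(\mathcal{M}\Lambda^1(T))$ as defined in the context. Then the sequence $$0 \to \mathbb{R} \xrightarrow{\ \subset\ } \mathcal{M}\Lambda^0(T) \xrightarrow{\ \mathrm{curl}\ } \chi(\mathcal{M}\Lambda^1(T)) \xrightarrow{\ \mathrm{div}\ } \mathbb{R} \to 0$$ is exact, and $\dim \mathcal{M}\Lambda^0(T) = n$, $\dim \chi(\mathcal{M}\Lambda^1(T)) = n$.
   Context: $T\subset\mathbb{R}^2$ is a (closed) convex polygon with vertices $\mathbf{v}_1,\dots,\mathbf{v}_n$. Generalized barycentric coordinates on $T$ are functions $\lambda_1,\dots,\lambda_n$ on $T$ that are non-negative on $T$ and satisfy linear precision: $L(\mathbf{x})=\sum_{i=1}^n L(\mathbf{v}_i)\lambda_i(\mathbf{x})$ for every linear (affine) function $L$ and all $\mathbf{x}\in T$; equivalently $\sum_i\lambda_i=1$ and $\sum_i\lambda_i(\mathbf{x})\mathbf{v}_i=\mathbf{x}$. Standing assumption: $\lambda_i(\mathbf{v}_j)=\delta_{ij}$, each $\lambda_i$ is linear on each edge of $T$, and $\lambda_i\in C^1(T)$ (continuously differentiable up to the boundary). For a scalar function $\phi$, $\mathrm{curl}\,\phi=(-\partial_y\phi,\partial_x\phi)^t$ (derivatives and divergences are understood weakly where needed). Let $\mathbf{x}_*$ be an arbitrary fixed point in the interior of $T$. Define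 $$\mathcal{M}\Lambda^0(T)=\mathrm{span}\{\lambda_i,\ 1\le i\le n\},\qquad \chi(\mathcal{M}\Lambda^1(T))=\mathrm{span}\{\mathrm{curl}\,\lambda_i,\ 1\le i\le n\}+\mathrm{span}\{\mathbf{x}-\mathbf{x}_*\}.$$ $\mathbb{R}$ denotes the constant functions on $T$. *)

theory Defs
  imports "HOL-Analysis.Analysis" "HOL-Library.Function_Algebras"
begin

text \<open>
  Pointwise scalar multiplication, so that \<^const>\<open>span\<close> and \<^const>\<open>dim\<close> apply to spaces of functions.
\<close>

instantiation "fun" :: (type, real_vector) real_vector
begin

definition scaleR_fun :: "real \<Rightarrow> ('a \<Rightarrow> 'b) \<Rightarrow> 'a \<Rightarrow> 'b"
  where "scaleR_fun c f = (\<lambda>x. c *\<^sub>R f x)"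

instance
  by standard (simp_all add: scaleR_fun_def plus_fun_def fun_eq_iff algebra_simps)

end

text \<open>
  A function on \<open>T\<close> is represented by the function on the whole plane that agrees with it on \<open>T\<close>
  and is zero elsewhere; equality of such functions is equality on \<open>T\<close>.
\<close>

definition on_set :: "'a set \<Rightarrow> ('a \<Rightarrow> 'b::zero) \<Rightarrow> 'a \<Rightarrow> 'b"
  where "on_set T f = (\<lambda>x. if x \<in> T then f x else 0)"

definition const_funs :: "'a set \<Rightarrow> ('a \<Rightarrow> 'b::zero) set"
  where "const_funs T = range (\<lambda>c. on_set T (\<lambda>x. c))"


definition convex_polygon :: "(real^2) set \<Rightarrow> nat \<Rightarrow> (nat \<Rightarrow> real^2) \<Rightarrow> bool"
  where "convex_polygon T n v \<longleftrightarrow>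
    polytope T \<and> interior T \<noteq> {} \<and> bij_betw v {1..n} {x. x extreme_point_of T}"

definition affine_fun :: "('a::real_vector \<Rightarrow> real) \<Rightarrow> bool"
  where "affine_fun L \<longleftrightarrow> (\<exists>l c. linear l \<and> (\<forall>x. L x = l x + c))"

definition gen_barycentric ::
    "(real^2) set \<Rightarrow> nat \<Rightarrow> (nat \<Rightarrow> real^2) \<Rightarrow> (nat \<Rightarrow> real^2 \<Rightarrow> real) \<Rightarrow> bool"
  where "gen_barycentric T n v lam \<longleftrightarrow>
    (\<forall>i\<in>{1..n}. \<forall>x\<in>T. 0 \<le> lam i x) \<and>
    (\<forall>L. affine_fun L \<longrightarrow> (\<forall>x\<in>T. L x = (\<Sum>i=1..n. L (v i) * lam i x)))"

text \<open>
  The derivative is taken within \<open>S\<close>. For a convex \<open>S\<close> with nonempty interior it is unique at every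
  point of \<open>S\<close>, boundary points and corners included, and it is the ordinary derivative at interior
  points; \<open>C1_on S f\<close> then means that \<open>f\<close> is continuously differentiable up to the boundary.
\<close>

definition partial_deriv :: "(real^'n) set \<Rightarrow> 'n \<Rightarrow> (real^'n \<Rightarrow> real) \<Rightarrow> real^'n \<Rightarrow> real"
  where "partial_deriv S i f x = frechet_derivative f (at x within S) (axis i 1)"

definition C1_on :: "(real^'n) set \<Rightarrow> (real^'n \<Rightarrow> real) \<Rightarrow> bool"
  where "C1_on S f \<longleftrightarrow> f differentiable_on S \<and> (\<forall>i. continuous_on S (partial_deriv S i f))"

definition curl :: "(real^2) set \<Rightarrow> (real^2 \<Rightarrow> real) \<Rightarrow> real^2 \<Rightarrow> real^2"
  where "curl T f = on_set T (\<lambda>x. vector [- partial_deriv T 2 f x, partial_deriv T 1 f x])"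


definition C_infinity :: "(real^'n \<Rightarrow> real) \<Rightarrow> bool"
  where "C_infinity f \<longleftrightarrow> (\<forall>is. foldr (partial_deriv UNIV) is f differentiable_on UNIV)"

definition test_function :: "(real^'n) set \<Rightarrow> (real^'n \<Rightarrow> real) \<Rightarrow> bool"
  where "test_function U f \<longleftrightarrow>
    C_infinity f \<and> compact (closure {x. f x \<noteq> 0}) \<and> closure {x. f x \<noteq> 0} \<subseteq> U"

definition has_weak_div :: "(real^'n) set \<Rightarrow> (real^'n \<Rightarrow> real^'n) \<Rightarrow> (real^'n \<Rightarrow> real) \<Rightarrow> bool"
  where "has_weak_div U F g \<longleftrightarrow>
    (\<forall>K. compact K \<and> K \<subseteq> U \<longrightarrow> set_integrable lborel K F \<and> set_integrable lborel K g) \<and>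
    (\<forall>f. test_function U f \<longrightarrow>
      (LINT x:U|lborel. F x \<bullet> (\<chi> i. partial_deriv UNIV i f x)) = - (LINT x:U|lborel. g x * f x))"

text \<open>
  The weak divergence in the interior of \<open>T\<close> is determined only almost everywhere; \<open>weak_div\<close> selects
  its representative that is continuous on \<open>T\<close>.
\<close>

definition weak_div :: "(real^'n) set \<Rightarrow> (real^'n \<Rightarrow> real^'n) \<Rightarrow> real^'n \<Rightarrow> real"
  where "weak_div T F =
    (THE g. continuous_on T g \<and> (\<forall>x. x \<notin> T \<longrightarrow> g x = 0) \<and> has_weak_div (interior T) F g)"


definition M_Lambda0 :: "(real^2) set \<Rightarrow> nat \<Rightarrow> (nat \<Rightarrow> real^2 \<Rightarrow> real) \<Rightarrow> (real^2 \<Rightarrow> real) set"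
  where "M_Lambda0 T n lam = span ((\<lambda>i. on_set T (lam i)) ` {1..n})"

definition chi_M_Lambda1 ::
    "(real^2) set \<Rightarrow> nat \<Rightarrow> (nat \<Rightarrow> real^2 \<Rightarrow> real) \<Rightarrow> real^2 \<Rightarrow> (real^2 \<Rightarrow> real^2) set"
  where "chi_M_Lambda1 T n lam xs =
    {F + G | F G. F \<in> span ((\<lambda>i. curl T (lam i)) ` {1..n}) \<and> G \<in> span {on_set T (\<lambda>x. x - xs)}}"


definition linear_between :: "'a::real_vector set \<Rightarrow> ('a \<Rightarrow> 'b::real_vector) \<Rightarrow> 'b set \<Rightarrow> bool"
  where "linear_between V f W \<longleftrightarrow> subspace V \<and> subspace W \<and> f ` V \<subseteq> W \<and>
    (\<forall>x\<in>V. \<forall>y\<in>V. f (x + y) = f x + f y) \<and> (\<forall>c. \<forall>x\<in>V. f (c *\<^sub>R x) = c *\<^sub>R f x)"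

definition exact_at ::
    "'a::real_vector set \<Rightarrow> ('a \<Rightarrow> 'b::real_vector) \<Rightarrow> 'b set \<Rightarrow> ('b \<Rightarrow> 'c::real_vector) \<Rightarrow> 'c set \<Rightarrow> bool"
  where "exact_at U f V g W \<longleftrightarrow>
    linear_between U f V \<and> linear_between V g W \<and> f ` U = {x \<in> V. g x = 0}"

end

(*
  The divergence of curl u vanishes weakly: integrating by parts against a test function f leaves the
  integral of u times the difference of the two mixed second derivatives of f. The divergence of
  x - xs is 2. So weak_div sends curl u + c (x - xs) to the constant 2 c, and its kernel consists of
  the curls. A function on the convex set T whose curl vanishes is constant, and the constants lie in
  the span of the lam i because these sum to 1. The values lam i (v j) make the lam i independent;
  a combination of lam 2, ..., lam n that is constant vanishes (evaluate at v 1), so the curls of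
  lam 2, ..., lam n together with x - xs form a basis.
*)
theory Submission
  imports Defs
begin

text \<open>The coordinates are only C1, so the curl of a member of \<open>M_Lambda0\<close> is
  merely continuous and its divergence cannot be computed pointwise: every derivative beyond the
  first has to fall on the test function. No boundary terms arise, because a test function lives on
  a compact subset of the interior and products with it extend by zero to the whole plane. As
  \<open>weak_div\<close> is a definite description, exhibiting a weak divergence does not yet
  determine its value: two continuous candidates must be shown equal, and this requires test
  functions that are positive on arbitrarily small balls. That is why a smooth bump is constructed.
  A similar difficulty affects \<open>curl\<close>: at boundary points
  \<open>frechet_derivative\<close> is a choice among the derivatives within \<open>T\<close>, and
  \<open>curl\<close> becomes linear only once convexity and nonempty interior make that derivative
  unique.\<close>

section \<open>Symmetry of mixed second derivatives\<close>

text \<open>Two applications of the mean value theorem: to the increment in direction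
  \<open>b\<close> as a function of the step along \<open>a\<close>, and then to
  \<open>f' _ a\<close> along \<open>b\<close>. The left-hand side of the equation is symmetric in
  \<open>a\<close> and \<open>b\<close>, which is what makes the formula useful.\<close>

lemma mixed_difference_eq_second_derivative:
  fixes f :: "'a::real_normed_vector \<Rightarrow> real"
  assumes f: "\<And>x. (f has_derivative f' x) (at x)"
    and f': "\<And>x. ((\<lambda>x. f' x a) has_derivative f'' x) (at x)"
    and "h > 0"
  obtains p where "dist x p \<le> h * (norm a + norm b)"
    and "f (x + h *\<^sub>R a + h *\<^sub>R b) - f (x + h *\<^sub>R a) - f (x + h *\<^sub>R b) + f x = h\<^sup>2 * f'' p b"
proof -
  define \<phi> where "\<phi> s = f (x + s *\<^sub>R a + h *\<^sub>R b) - f (x + s *\<^sub>R a)" for s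
  have d\<phi>: "(\<phi> has_derivative (\<lambda>d. f' (x + s *\<^sub>R a + h *\<^sub>R b) (d *\<^sub>R a) - f' (x + s *\<^sub>R a) (d *\<^sub>R a))) (at s)" for s
    unfolding \<phi>_def
    by (rule has_derivative_diff; rule has_derivative_compose[OF _ f])
       (auto intro!: derivative_eq_intros)
  obtain s where s: "0 < s" "s < h" and
    "\<phi> h - \<phi> 0 = f' (x + s *\<^sub>R a + h *\<^sub>R b) (h *\<^sub>R a) - f' (x + s *\<^sub>R a) (h *\<^sub>R a)"
    using mvt_simple[OF \<open>h > 0\<close> has_derivative_at_withinI[OF d\<phi>]] by auto
  then have 1: "\<phi> h - \<phi> 0 = h * (f' (x + s *\<^sub>R a + h *\<^sub>R b) a - f' (x + s *\<^sub>R a) a)"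
    by (simp add: linear_scale[OF has_derivative_linear[OF f]] right_diff_distrib)
  define \<psi> where "\<psi> t = f' (x + s *\<^sub>R a + t *\<^sub>R b) a" for t
  have d\<psi>: "(\<psi> has_derivative (\<lambda>d. f'' (x + s *\<^sub>R a + t *\<^sub>R b) (d *\<^sub>R b))) (at t)" for t
    unfolding \<psi>_def
    by (rule has_derivative_compose[OF _ f']) (auto intro!: derivative_eq_intros)
  obtain t where t: "0 < t" "t < h" and
    "\<psi> h - \<psi> 0 = f'' (x + s *\<^sub>R a + t *\<^sub>R b) (h *\<^sub>R b)"
    using mvt_simple[OF \<open>h > 0\<close> has_derivative_at_withinI[OF d\<psi>]] by auto
  then have 2: "\<psi> h - \<psi> 0 = h * f'' (x + s *\<^sub>R a + t *\<^sub>R b) b"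
    by (simp add: linear_scale[OF has_derivative_linear[OF f']])
  have "dist x (x + s *\<^sub>R a + t *\<^sub>R b) = norm (s *\<^sub>R a + t *\<^sub>R b)"
    by (metis add.assoc add_diff_cancel_left' dist_commute dist_norm)
  also have "\<dots> \<le> s * norm a + t * norm b"
    using s t norm_triangle_ineq[of "s *\<^sub>R a" "t *\<^sub>R b"] by simp
  also have "\<dots> \<le> h * (norm a + norm b)"
    using s t by (simp add: distrib_left add_mono mult_right_mono)
  finally show thesis
    using that[of "x + s *\<^sub>R a + t *\<^sub>R b"] 1 2
    by (simp add: \<phi>_def \<psi>_def power2_eq_square)
qed

text \<open>The symmetric mixed difference equals both \<open>h\<^sup>2 * fa p b\<close> and
  \<open>h\<^sup>2 * fb q a\<close>. After cancelling the square, \<open>p\<close> and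
  \<open>q\<close> are squeezed to \<open>x\<close> as \<open>h\<close> tends to 0, and continuity
  at \<open>x\<close> gives equality. Only derivatives of the two directional derivatives enter,
  which is the form in which iterated partial derivatives supply them.\<close>

lemma second_derivatives_commute:
  fixes f :: "'a::real_normed_vector \<Rightarrow> real"
  assumes f: "\<And>x. (f has_derivative f' x) (at x)"
    and fa: "\<And>x. ((\<lambda>x. f' x a) has_derivative fa x) (at x)"
    and fb: "\<And>x. ((\<lambda>x. f' x b) has_derivative fb x) (at x)"
    and cont: "isCont (\<lambda>x. fa x b) x" "isCont (\<lambda>x. fb x a) x"
  shows "fa x b = fb x a"
proof -
  define h where "h k = 1 / real (Suc k)" for k
  have h: "h k > 0" for k
    by (simp add: h_def)
  have "\<exists>p. dist x p \<le> h k * (norm a + norm b) \<and>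
      f (x + h k *\<^sub>R a + h k *\<^sub>R b) - f (x + h k *\<^sub>R a) - f (x + h k *\<^sub>R b) + f x = (h k)\<^sup>2 * fa p b" for k
    by (rule mixed_difference_eq_second_derivative[where x = x and b = b, OF f fa h[of k]]) blast
  from choice[OF allI, OF this] obtain p where p: "\<forall>k. dist x (p k) \<le> h k * (norm a + norm b) \<and>
      f (x + h k *\<^sub>R a + h k *\<^sub>R b) - f (x + h k *\<^sub>R a) - f (x + h k *\<^sub>R b) + f x = (h k)\<^sup>2 * fa (p k) b" ..
  have "\<exists>q. dist x q \<le> h k * (norm b + norm a) \<and>
      f (x + h k *\<^sub>R b + h k *\<^sub>R a) - f (x + h k *\<^sub>R b) - f (x + h k *\<^sub>R a) + f x = (h k)\<^sup>2 * fb q a" for k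
    by (rule mixed_difference_eq_second_derivative[where x = x and b = a, OF f fb h[of k]]) blast
  from choice[OF allI, OF this] obtain q where q: "\<forall>k. dist x (q k) \<le> h k * (norm b + norm a) \<and>
      f (x + h k *\<^sub>R b + h k *\<^sub>R a) - f (x + h k *\<^sub>R b) - f (x + h k *\<^sub>R a) + f x = (h k)\<^sup>2 * fb (q k) a" ..
  have "h \<longlonglongrightarrow> 0"
    unfolding h_def using LIMSEQ_inverse_real_of_nat by (simp add: inverse_eq_divide)
  then have lim: "(\<lambda>k. h k * c) \<longlonglongrightarrow> 0" for c
    by (rule tendsto_mult_left_zero)
  have "(\<lambda>k. dist x (p k)) \<longlonglongrightarrow> 0"
    by (rule tendsto_sandwich[OF _ _ tendsto_const lim[of "norm a + norm b"]]) (simp_all add: p)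
  then have "p \<longlonglongrightarrow> x"
    by (subst tendsto_dist_iff) (simp add: dist_commute)
  then have P: "(\<lambda>k. fa (p k) b) \<longlonglongrightarrow> fa x b"
    by (rule isCont_tendsto_compose[OF cont(1)])
  have "(\<lambda>k. dist x (q k)) \<longlonglongrightarrow> 0"
    by (rule tendsto_sandwich[OF _ _ tendsto_const lim[of "norm b + norm a"]]) (simp_all add: q)
  then have "q \<longlonglongrightarrow> x"
    by (subst tendsto_dist_iff) (simp add: dist_commute)
  then have Q: "(\<lambda>k. fb (q k) a) \<longlonglongrightarrow> fb x a"
    by (rule isCont_tendsto_compose[OF cont(2)])
  have "fa (p k) b = fb (q k) a" for k
  proof -
    have "(h k)\<^sup>2 * fa (p k) b = (h k)\<^sup>2 * fb (q k) a"
      using p[rule_format, of k] q[rule_format, of k] by (simp add: algebra_simps)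
    then show ?thesis
      using h[of k] by simp
  qed
  with P have "(\<lambda>k. fb (q k) a) \<longlonglongrightarrow> fa x b"
    by simp
  then show ?thesis
    using Q by (rule LIMSEQ_unique)
qed

section \<open>Integration by parts with compact support\<close>

lemma integrable_continuous_compact_support:
  fixes g :: "'a::euclidean_space \<Rightarrow> 'b::{banach, second_countable_topology}"
  assumes "continuous_on UNIV g" "compact K" "\<And>x. x \<notin> K \<Longrightarrow> g x = 0"
  shows "integrable lborel g"
proof -
  have "integrable lborel (\<lambda>x. indicator K x *\<^sub>R g x)"
    using assms continuous_on_subset[OF assms(1)] by (intro borel_integrable_compact) auto
  also have "(\<lambda>x. indicator K x *\<^sub>R g x) = g"
    using assms(3) by (auto simp: indicator_def)
  finally show ?thesis .
qed

text \<open>Because \<open>K \<subseteq> U\<close>, the open sets \<open>U\<close> and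
  \<open>- K\<close> cover the space; on \<open>U\<close> the extension is \<open>f\<close>, on
  \<open>- K\<close> it is 0. The indicator form is the integrand to which integrals over
  \<open>U\<close> unfold.\<close>

lemma continuous_on_zero_extension:
  fixes f :: "'a::t2_space \<Rightarrow> 'b::real_normed_vector"
  assumes "open U" "compact K" "continuous_on U f" "\<And>x. x \<in> U - K \<Longrightarrow> f x = 0" "K \<subseteq> U"
  shows "continuous_on UNIV (\<lambda>x. indicator U x *\<^sub>R f x)"
proof -
  have "continuous_on (U \<union> - K) (\<lambda>x. indicator U x *\<^sub>R f x)"
  proof (rule continuous_on_open_Un)
    show "open (- K)"
      using assms(2) by (simp add: compact_imp_closed open_Compl)
    show "continuous_on U (\<lambda>x. indicator U x *\<^sub>R f x)"
      using assms(3) by (rule continuous_on_eq) auto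
    show "continuous_on (- K) (\<lambda>x. indicator U x *\<^sub>R f x)"
      by (rule continuous_on_eq[of _ "\<lambda>_. 0"]) (use assms(4) in \<open>auto simp: indicator_def\<close>)
  qed fact
  moreover have "U \<union> - K = UNIV"
    using assms(5) by auto
  ultimately show ?thesis by simp
qed

lemma integral_translation_lborel:
  fixes g :: "'a::euclidean_space \<Rightarrow> real"
  assumes "g \<in> borel_measurable borel"
  shows "(LINT x|lborel. g (c + x)) = (LINT x|lborel. g x)"
  using integral_distr[of "(+) c" lborel borel g] assms by (simp add: lborel_distr_plus)

text \<open>
  By translation invariance every difference quotient of \<open>g\<close> has integral zero, so no Fubini
  argument is needed.
\<close>

lemma integral_derivative_compact_support:
  fixes g :: "'a::euclidean_space \<Rightarrow> real"
  assumes g: "\<And>x. (g has_derivative g' x) (at x)"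
    and cont: "continuous_on UNIV (\<lambda>x. g' x b)"
    and K: "compact K" "\<And>x. x \<notin> K \<Longrightarrow> g x = 0"
  shows "(LINT x|lborel. g' x b) = 0"
proof -
  define h where "h k = 1 / real (Suc k)" for k
  have h: "0 < h k" "h k \<le> 1" for k
    by (simp_all add: h_def)
  have contg: "continuous_on UNIV g"
    by (intro continuous_at_imp_continuous_on ballI has_derivative_continuous[OF g])
  have meas: "g \<in> borel_measurable borel"
    using contg by (rule borel_measurable_continuous_onI)
  have g'0: "g' x b = 0" if "x \<notin> K" for x
  proof -
    have "(g has_derivative (\<lambda>_. 0)) (at x)"
      by (rule has_derivative_transform_within_open[where s="- K" and f="\<lambda>_. 0"])
         (use that K in \<open>auto simp: compact_imp_closed open_Compl\<close>)
    then show ?thesis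
      using has_derivative_unique[OF g] by metis
  qed
  have "continuous_on K (\<lambda>x. g' x b)"
    by (rule continuous_on_subset[OF cont]) simp
  then have "bounded ((\<lambda>x. g' x b) ` K)"
    by (intro compact_imp_bounded compact_continuous_image K(1))
  then obtain M where "M > 0" and M: "\<And>x. x \<in> K \<Longrightarrow> norm (g' x b) \<le> M"
    by (auto simp: bounded_pos)
  then have M: "norm (g' x b) \<le> M" for x
    using g'0[of x] by (cases "x \<in> K") auto
  \<comment> \<open>\<open>K\<close> is enlarged by the radius \<open>norm b\<close>. As
    \<open>h k \<le> 1\<close>, neither \<open>x\<close> nor \<open>x\<close> shifted by
    \<open>h k *\<^sub>R b\<close> lies in \<open>K\<close> when \<open>x\<close> is outside
    \<open>K'\<close>. So all difference quotients vanish outside one compact set, and one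
    integrable function dominates them.\<close>
  define K' where "K' = {x + y | x y. x \<in> K \<and> y \<in> cball 0 (norm b)}"
  have K': "compact K'"
    unfolding K'_def using K(1) by (intro compact_sums) auto
  let ?q = "\<lambda>k x. (g (h k *\<^sub>R b + x) - g x) / h k"
  have bound: "norm (?q k x) \<le> M * indicator K' x" for k x
  proof (cases "x \<in> K'")
    case True
    define \<phi> where "\<phi> s = g (x + s *\<^sub>R b)" for s
    have d\<phi>: "(\<phi> has_derivative (\<lambda>d. g' (x + s *\<^sub>R b) (d *\<^sub>R b))) (at s)" for s
      unfolding \<phi>_def
      by (rule has_derivative_compose[OF _ g]) (auto intro!: derivative_eq_intros)
    obtain s where
      "\<phi> (h k) - \<phi> 0 = g' (x + s *\<^sub>R b) (h k *\<^sub>R b)"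
      using mvt_simple[OF h(1)[of k] has_derivative_at_withinI[OF d\<phi>]] by auto
    then have "g (h k *\<^sub>R b + x) - g x = h k * g' (x + s *\<^sub>R b) b"
      by (simp add: \<phi>_def linear_scale[OF has_derivative_linear[OF g]] add.commute)
    then show ?thesis
      using h(1)[of k] M[of "x + s *\<^sub>R b"] True by simp
  next
    case False
    have "x \<notin> K"
    proof
      assume "x \<in> K"
      then have "x + 0 \<in> K'"
        unfolding K'_def by fastforce
      with False show False by simp
    qed
    moreover have "h k *\<^sub>R b + x \<notin> K"
    proof
      assume *: "h k *\<^sub>R b + x \<in> K"
      have "norm (- (h k *\<^sub>R b)) \<le> norm b"
        using h[of k] by (simp add: mult_left_le_one_le)
      then have "(h k *\<^sub>R b + x) + - (h k *\<^sub>R b) \<in> K'"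
        unfolding K'_def using * by (intro CollectI exI conjI) (auto simp only: mem_cball_0)
      with False show False by simp
    qed
    ultimately show ?thesis
      using K(2) False by simp
  qed
  have "(\<lambda>k. LINT x|lborel. ?q k x) \<longlonglongrightarrow> (LINT x|lborel. g' x b)"
  proof (rule integral_dominated_convergence[where w="\<lambda>x. M * indicator K' x"])
    show "(\<lambda>x. g' x b) \<in> borel_measurable lborel"
      using borel_measurable_continuous_onI[OF cont] by simp
    show "?q k \<in> borel_measurable lborel" for k
      using meas by measurable
    have "integrable lborel (indicator K' :: 'a \<Rightarrow> real)"
      using K' borel_integrable_compact[of K' "\<lambda>_. 1::real"] by simp
    then show "integrable lborel (\<lambda>x. M * indicator K' x)"
      by simp
    show "AE x in lborel. (\<lambda>k. ?q k x) \<longlonglongrightarrow> g' x b"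
    proof (intro AE_I2)
      fix x
      have "((\<lambda>s. g (x + s *\<^sub>R b)) has_derivative (\<lambda>d. g' x (d *\<^sub>R b))) (at 0)"
        by (rule has_derivative_compose[of _ _ _ _ g]) (use g[of x] in \<open>auto intro!: derivative_eq_intros\<close>)
      then have "((\<lambda>s. g (x + s *\<^sub>R b)) has_field_derivative g' x b) (at 0)"
        by (simp add: has_field_derivative_def linear_scale[OF has_derivative_linear[OF g]] mult.commute[of _ "g' x b"])
      then have "((\<lambda>s. (g (x + s *\<^sub>R b) - g x) / s) \<longlongrightarrow> g' x b) (at 0)"
        by (simp add: DERIV_def)
      moreover have "filterlim h (at 0) sequentially"
        using LIMSEQ_inverse_real_of_nat by (simp add: filterlim_at h_def[abs_def] inverse_eq_divide)
      ultimately have "(\<lambda>k. (g (x + h k *\<^sub>R b) - g x) / h k) \<longlonglongrightarrow> g' x b"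
        by (rule filterlim_compose)
      then show "(\<lambda>k. ?q k x) \<longlonglongrightarrow> g' x b"
        by (simp add: add.commute)
    qed
    show "AE x in lborel. norm (?q k x) \<le> M * indicator K' x" for k
      using bound by blast
  qed
  moreover have "(LINT x|lborel. ?q k x) = 0" for k
  proof -
    have int: "integrable lborel g"
      using contg K by (rule integrable_continuous_compact_support)
    then have int': "integrable lborel (\<lambda>x. g (h k *\<^sub>R b + x))"
      using integrable_distr[of "(+) (h k *\<^sub>R b)" lborel borel g] by (simp add: lborel_distr_plus)
    have "(LINT x|lborel. g (h k *\<^sub>R b + x) - g x) = 0"
      using int int' integral_translation_lborel[OF meas] by simp
    then show ?thesis by simp
  qed
  ultimately have "(\<lambda>_. 0) \<longlonglongrightarrow> (LINT x|lborel. g' x b)"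
    by (simp only:)
  then show ?thesis
    by (simp add: LIMSEQ_const_iff)
qed

text \<open>\<open>u\<close> is differentiable only on \<open>U\<close>, but \<open>u * w\<close>
  extended by zero is differentiable everywhere, since \<open>w\<close> vanishes outside the compact
  set \<open>K\<close> inside \<open>U\<close>. The integral of its derivative in direction
  \<open>b\<close> is zero, and the product rule splits that integral.\<close>

lemma set_integral_by_parts_compact_support:
  fixes u w :: "'a::euclidean_space \<Rightarrow> real"
  assumes U: "open U" and K: "compact K" "K \<subseteq> U"
    and u: "\<And>x. x \<in> U \<Longrightarrow> (u has_derivative u' x) (at x)" "continuous_on U (\<lambda>x. u' x b)"
    and w: "\<And>x. (w has_derivative w' x) (at x)" "continuous_on UNIV (\<lambda>x. w' x b)"
      "\<And>x. x \<notin> K \<Longrightarrow> w x = 0"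
  shows "set_integrable lborel U (\<lambda>x. u' x b * w x)" (is ?int1)
    and "set_integrable lborel U (\<lambda>x. u x * w' x b)" (is ?int2)
    and "(LINT x:U|lborel. u' x b * w x) = - (LINT x:U|lborel. u x * w' x b)" (is ?eq)
proof -
  have w'0: "w' x = (\<lambda>_. 0)" if "x \<notin> K" for x
  proof -
    have "(w has_derivative (\<lambda>_. 0)) (at x)"
      by (rule has_derivative_transform_within_open[where s="- K" and f="\<lambda>_. 0"])
         (use that K w(3) in \<open>auto simp: compact_imp_closed open_Compl\<close>)
    then show ?thesis
      by (rule has_derivative_unique[OF w(1)])
  qed
  have contu: "continuous_on U u"
    by (intro continuous_at_imp_continuous_on ballI has_derivative_continuous[OF u(1)])
  have contw: "continuous_on U w"
    by (intro continuous_at_imp_continuous_on ballI has_derivative_continuous[OF w(1)])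
  have c1: "continuous_on UNIV (\<lambda>x. indicator U x *\<^sub>R (u' x b * w x))"
    by (rule continuous_on_zero_extension[OF U K(1) continuous_on_mult[OF u(2) contw]])
       (use w(3) K in auto)
  have c2: "continuous_on UNIV (\<lambda>x. indicator U x *\<^sub>R (u x * w' x b))"
    by (rule continuous_on_zero_extension[OF U K(1) continuous_on_mult[OF contu]])
       (use w'0 K continuous_on_subset[OF w(2)] in auto)
  show i1: ?int1
    unfolding set_integrable_def
    using w(3) by (intro integrable_continuous_compact_support[OF c1 K(1)]) auto
  show i2: ?int2
    unfolding set_integrable_def
    using w'0 by (intro integrable_continuous_compact_support[OF c2 K(1)]) auto
  define g where "g x = indicator U x * (u x * w x)" for x
  define g' where "g' x d = indicator U x * (u' x d * w x + u x * w' x d)" for x d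
  have "(g has_derivative g' x) (at x)" for x
  proof (cases "x \<in> U")
    case True
    have "((\<lambda>x. u x * w x) has_derivative g' x) (at x)"
      using True by (auto intro!: derivative_eq_intros u(1) w(1) simp: g'_def)
    then show ?thesis
      by (rule has_derivative_transform_within_open[OF _ U True]) (simp add: g_def)
  next
    case False
    have "g' x = (\<lambda>_. 0)"
      using False by (simp add: g'_def fun_eq_iff)
    moreover have "(g has_derivative (\<lambda>_. 0)) (at x)"
      by (rule has_derivative_transform_within_open[where s="- K" and f="\<lambda>_. 0"])
         (use K w(3) False in \<open>auto simp: compact_imp_closed open_Compl g_def\<close>)
    ultimately show ?thesis by simp
  qed
  moreover have "continuous_on UNIV (\<lambda>x. g' x b)"
    using continuous_on_add[OF c1 c2] by (simp add: g'_def distrib_left)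
  moreover have "g x = 0" if "x \<notin> K" for x
    using that w(3) by (simp add: g_def)
  ultimately have "(LINT x|lborel. g' x b) = 0"
    using K(1) by (intro integral_derivative_compact_support)
  then have "(LINT x:U|lborel. u' x b * w x + u x * w' x b) = 0"
    by (simp add: g'_def set_lebesgue_integral_def)
  then show ?eq
    using set_integral_add(2)[OF i1 i2] by simp
qed

section \<open>Smooth bump functions\<close>

text \<open>For \<open>k = 0\<close> this is the classical function that is smooth but flat at 0.
  The powers in the denominator are those that its derivatives produce, so the whole family can be
  treated at once.\<close>

definition flat_exp :: "nat \<Rightarrow> real \<Rightarrow> real"
  where "flat_exp k s = (if s > 0 then exp (- (1 / s)) / s ^ k else 0)"

text \<open>With \<open>t = 1 / s\<close> the limit from the right becomes the decay of
  \<open>t ^ k / exp t\<close> at infinity.\<close>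

lemma flat_exp_tendsto_0: "(flat_exp k \<longlongrightarrow> 0) (at 0)"
proof (rule filterlim_split_at)
  show "(flat_exp k \<longlongrightarrow> 0) (at_left 0)"
    by (rule tendsto_eventually) (auto simp: flat_exp_def eventually_at_filter)
  have "((\<lambda>s. inverse s ^ k / exp (inverse s)) \<longlongrightarrow> (0::real)) (at_right 0)"
    by (rule filterlim_compose[OF tendsto_power_div_exp_0 filterlim_inverse_at_top_right])
  then show "(flat_exp k \<longlongrightarrow> 0) (at_right 0)"
    by (rule filterlim_mono_eventually[OF _ order_refl order_refl])
      (auto simp: flat_exp_def eventually_at_filter exp_minus field_simps)
qed

text \<open>Derivatives are linear combinations of members of the same family. At 0 the difference
  quotient of \<open>flat_exp k\<close> is \<open>flat_exp (Suc k)\<close> itself, so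
  differentiability there reduces to the limit already established.\<close>

lemma flat_exp_has_real_derivative:
  "(flat_exp k has_real_derivative flat_exp (k + 2) s - real k * flat_exp (k + 1) s) (at s)"
proof -
  consider "s > 0" | "s < 0" | "s = 0" by linarith
  then show ?thesis
  proof cases
    case 1
    have "((\<lambda>s. exp (- (1 / s)) / s ^ k) has_real_derivative
        (exp (- (1 / s)) * (1 / s\<^sup>2) * s ^ k - exp (- (1 / s)) * (real k * s ^ (k - 1))) / (s ^ k * s ^ k)) (at s)"
      using 1 by (auto intro!: derivative_eq_intros simp: power2_eq_square)
    \<comment> \<open>This form avoids the truncated exponent \<open>k - 1\<close>; for
      \<open>k = 0\<close> both sides are 0 because of the factor \<open>real k\<close>.\<close>
    also have "real k * s ^ (k - 1) = real k * s ^ k / s"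
      using 1 by (cases k) auto
    also have "(exp (- (1 / s)) * (1 / s\<^sup>2) * s ^ k - exp (- (1 / s)) * (real k * s ^ k / s)) / (s ^ k * s ^ k)
        = flat_exp (k + 2) s - real k * flat_exp (k + 1) s"
      using 1 by (simp add: flat_exp_def field_simps power2_eq_square)
    finally have "((\<lambda>s. exp (- (1 / s)) / s ^ k) has_real_derivative
        flat_exp (k + 2) s - real k * flat_exp (k + 1) s) (at s)" .
    then show ?thesis
      by (rule has_field_derivative_transform_within_open[of _ _ _ "{0<..}"])
        (use 1 in \<open>auto simp: flat_exp_def\<close>)
  next
    case 2
    have "((\<lambda>_. 0) has_real_derivative 0) (at s)"
      by simp
    then have "(flat_exp k has_real_derivative 0) (at s)"
      by (rule has_field_derivative_transform_within_open[of _ _ _ "{..<0}"])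
        (use 2 in \<open>auto simp: flat_exp_def\<close>)
    with 2 show ?thesis
      by (simp add: flat_exp_def)
  next
    case 3
    have "(flat_exp k (0 + h) - flat_exp k 0) / h = flat_exp (Suc k) h" for h
      by (auto simp: flat_exp_def)
    then have "(\<lambda>h. (flat_exp k (0 + h) - flat_exp k 0) / h) \<midarrow>0\<rightarrow> 0"
      using flat_exp_tendsto_0[of "Suc k"] by (simp only:)
    moreover have "flat_exp (k + 2) 0 - real k * flat_exp (k + 1) 0 = 0"
      by (simp add: flat_exp_def)
    ultimately show ?thesis
      using 3 by (simp only: DERIV_def)
  qed
qed

text \<open>
  An algebra of functions that contains the bump \<open>exp (- 1 / (r\<^sup>2 - |x - a|\<^sup>2))\<close> and is closed under
  partial derivatives.
\<close>

inductive bump_algebra :: "real^'n \<Rightarrow> real \<Rightarrow> (real^'n \<Rightarrow> real) \<Rightarrow> bool"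
  for a :: "real^'n" and r :: real where
  const: "bump_algebra a r (\<lambda>x. c)"
| coord: "bump_algebra a r (\<lambda>x. x $ i - a $ i)"
| bump: "bump_algebra a r (\<lambda>x. flat_exp k (r\<^sup>2 - (x - a) \<bullet> (x - a)))"
| add: "bump_algebra a r f \<Longrightarrow> bump_algebra a r g \<Longrightarrow> bump_algebra a r (\<lambda>x. f x + g x)"
| mult: "bump_algebra a r f \<Longrightarrow> bump_algebra a r g \<Longrightarrow> bump_algebra a r (\<lambda>x. f x * g x)"

text \<open>Existence of the derivative and closure under partial derivatives are proved together,
  so that differentiation can be iterated without leaving the algebra.\<close>

lemma bump_algebra_has_derivative:
  assumes "bump_algebra a r f"
  shows "\<exists>f'. (\<forall>x. (f has_derivative f' x) (at x)) \<and> (\<forall>i. bump_algebra a r (\<lambda>x. f' x (axis i 1)))"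
  using assms
proof induction
  case (const c)
  show ?case
    by (rule exI[of _ "\<lambda>_ _. 0"]) (auto intro: bump_algebra.const)
next
  case (coord i)
  have "((\<lambda>x. x $ i - a $ i) has_derivative (\<lambda>d. d $ i)) (at x)" for x
    by (auto intro!: derivative_eq_intros bounded_linear_imp_has_derivative)
  then show ?case
    by (intro exI[of _ "\<lambda>_ d. d $ i"]) (auto intro: bump_algebra.const)
next
  case (bump k)
  let ?q = "\<lambda>x. r\<^sup>2 - (x - a) \<bullet> (x - a)"
  \<comment> \<open>The difference is written as a sum with the constant factor
    \<open>- real k\<close>, because the closure rules offer only constants, sums and
    products.\<close>
  let ?d = "\<lambda>x. flat_exp (k + 2) (?q x) + (- real k) * flat_exp (k + 1) (?q x)"
  have "((\<lambda>x. flat_exp k (?q x)) has_derivative (\<lambda>d. ?d x * (- 2 * ((x - a) \<bullet> d)))) (at x)" for x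
  proof -
    have q: "(?q has_derivative (\<lambda>d. - 2 * ((x - a) \<bullet> d))) (at x)"
      by (auto intro!: derivative_eq_intros simp: inner_commute)
    show ?thesis
      using has_derivative_compose[OF q flat_exp_has_real_derivative[of k "?q x", unfolded has_field_derivative_def]]
      by simp
  qed
  moreover have "bump_algebra a r (\<lambda>x. ?d x * (- 2 * ((x - a) \<bullet> axis i 1)))" for i
  proof -
    have "bump_algebra a r (\<lambda>x. ?d x * (- 2 * (x $ i - a $ i)))"
      by (intro bump_algebra.intros)
    then show ?thesis
      by (simp only: inner_axis inner_real_def mult_1_right vector_minus_component)
  qed
  ultimately show ?case
    by (intro exI[of _ "\<lambda>x d. ?d x * (- 2 * ((x - a) \<bullet> d))"]) simp
next
  case (add f g)
  then obtain f' g' where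
    f': "\<And>x. (f has_derivative f' x) (at x)" "\<And>i. bump_algebra a r (\<lambda>x. f' x (axis i 1))" and
    g': "\<And>x. (g has_derivative g' x) (at x)" "\<And>i. bump_algebra a r (\<lambda>x. g' x (axis i 1))"
    by auto
  show ?case
    by (rule exI[of _ "\<lambda>x d. f' x d + g' x d"])
      (auto intro!: derivative_eq_intros f' g' bump_algebra.add)
next
  case (mult f g)
  then obtain f' g' where
    f': "\<And>x. (f has_derivative f' x) (at x)" "\<And>i. bump_algebra a r (\<lambda>x. f' x (axis i 1))" and
    g': "\<And>x. (g has_derivative g' x) (at x)" "\<And>i. bump_algebra a r (\<lambda>x. g' x (axis i 1))"
    by auto
  show ?case
    by (rule exI[of _ "\<lambda>x d. f x * g' x d + f' x d * g x"])
      (auto intro!: has_derivative_mult f' g' bump_algebra.add bump_algebra.mult mult.hyps)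
qed

lemma partial_deriv_eqI:
  assumes "\<And>x. (f has_derivative f' x) (at x)"
  shows "partial_deriv UNIV i f = (\<lambda>x. f' x (axis i 1))"
  using frechet_derivative_at[OF assms] by (simp add: partial_deriv_def fun_eq_iff)

lemma bump_algebra_C_infinity:
  assumes "bump_algebra a r f"
  shows "C_infinity f"
proof -
  have "bump_algebra a r (foldr (partial_deriv UNIV) is f)" for "is"
  proof (induction "is")
    case (Cons i "is")
    from bump_algebra_has_derivative[OF this] obtain f' where
      "\<And>x. (foldr (partial_deriv UNIV) is f has_derivative f' x) (at x)"
      "bump_algebra a r (\<lambda>x. f' x (axis i 1))"
      by auto
    then show ?case
      by (simp add: partial_deriv_eqI[of _ f'])
  qed (use assms in simp)
  then have "\<exists>f'. \<forall>x. (foldr (partial_deriv UNIV) is f has_derivative f' x) (at x)" for "is"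
    using bump_algebra_has_derivative by fast
  then show ?thesis
    unfolding C_infinity_def differentiable_on_def differentiable_def by simp metis
qed

lemma C_infinity_partial_deriv:
  assumes "C_infinity f"
  shows "C_infinity (partial_deriv UNIV i f)"
  unfolding C_infinity_def
proof
  fix "is"
  show "foldr (partial_deriv UNIV) is (partial_deriv UNIV i f) differentiable_on UNIV"
    \<comment> \<open>\<open>foldr\<close> applies the last entry of the list first, so a derivative
      taken before all others is appended at the end.\<close>
    using assms[unfolded C_infinity_def, THEN spec, of "is @ [i]"] by simp
qed

lemma C_infinity_has_derivative:
  assumes "C_infinity f"
  shows "(f has_derivative frechet_derivative f (at x)) (at x)"
  using assms[unfolded C_infinity_def, THEN spec, of "[]"]
  by (simp add: differentiable_on_def frechet_derivative_works)

lemma C_infinity_continuous_on: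
  assumes "C_infinity f"
  shows "continuous_on S f"
  by (intro continuous_at_imp_continuous_on ballI
      has_derivative_continuous[OF C_infinity_has_derivative[OF assms]])

text \<open>\<open>flat_exp 0\<close> is positive exactly at positive arguments, and
  \<open>r\<^sup>2 - (x - a) \<bullet> (x - a)\<close> is positive exactly on the open ball. The
  support is the closure of that ball, hence the hypothesis on \<open>cball a r\<close>.\<close>

lemma test_function_bump:
  fixes a :: "real^'n"
  assumes "r > 0" "cball a r \<subseteq> U"
  obtains f where "test_function U f" "\<And>x. f x \<ge> 0" "\<And>x. f x > 0 \<longleftrightarrow> x \<in> ball a r"
proof
  define f where "f x = flat_exp 0 (r\<^sup>2 - (x - a) \<bullet> (x - a))" for x
  have *: "0 < r\<^sup>2 - (x - a) \<bullet> (x - a) \<longleftrightarrow> x \<in> ball a r" for x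
  proof -
    have "(x - a) \<bullet> (x - a) = (dist a x)\<^sup>2"
      by (metis dist_commute dist_norm power2_norm_eq_inner)
    then show ?thesis
      using assms(1) power2_less_imp_less[of "dist a x" r] power_strict_mono[of "dist a x" r 2] by auto
  qed
  show "f x \<ge> 0" "f x > 0 \<longleftrightarrow> x \<in> ball a r" for x
    unfolding f_def flat_exp_def using * by auto
  then have "{x. f x \<noteq> 0} = ball a r"
    by (auto simp: less_le)
  moreover have "C_infinity f"
    unfolding f_def[abs_def] by (rule bump_algebra_C_infinity[of a r]) (rule bump_algebra.bump)
  ultimately show "test_function U f"
    using assms by (simp add: test_function_def)
qed

section \<open>Test functions and uniqueness of the continuous weak divergence\<close>

text \<open>This is the fundamental lemma of the calculus of variations. If \<open>g a\<close> were
  nonzero, \<open>g\<close> would keep its sign on a ball around \<open>a\<close>. Times a bump on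
  that ball and the sign \<open>s\<close>, it becomes a nonnegative function with integral 0, hence
  zero almost everywhere, yet it is positive on a ball of positive measure.\<close>

lemma eq_0_if_orthogonal_to_test_functions:
  fixes g :: "real^'n \<Rightarrow> real"
  assumes U: "open U" and g: "continuous_on U g"
    and orth: "\<And>f. test_function U f \<Longrightarrow> (LINT x:U|lborel. g x * f x) = 0"
    and "a \<in> U"
  shows "g a = 0"
proof (rule ccontr)
  assume "g a \<noteq> 0"
  define s where "s = sgn (g a)"
  define V where "V = {x \<in> U. s * g x > 0}"
  have "open V"
  proof -
    have "V = U \<inter> (\<lambda>x. s * g x) -` {0<..}"
      by (auto simp: V_def)
    moreover have "continuous_on U (\<lambda>x. s * g x)"
      by (intro continuous_intros g)
    ultimately show ?thesis
      by (simp add: continuous_open_preimage U)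
  qed
  moreover have "a \<in> V"
    using \<open>a \<in> U\<close> \<open>g a \<noteq> 0\<close> by (auto simp: V_def s_def sgn_if)
  ultimately obtain r where r: "r > 0" "cball a r \<subseteq> V"
    by (auto simp: open_contains_cball)
  then have rU: "cball a r \<subseteq> U"
    by (auto simp: V_def)
  obtain f where f: "test_function U f" "\<And>x. f x \<ge> 0" "\<And>x. f x > 0 \<longleftrightarrow> x \<in> ball a r"
    using test_function_bump[OF r(1) rU] by blast
  have f0: "f x = 0" if "x \<notin> cball a r" for x
    using f(2,3)[of x] that by (auto simp: less_le)
  have "C_infinity f"
    using f(1) by (simp add: test_function_def)
  define h where "h x = indicator U x *\<^sub>R (s * g x * f x)" for x
  have "continuous_on UNIV h"
    unfolding h_def
    by (rule continuous_on_zero_extension[OF U, of "cball a r"])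
      (use f0 rU continuous_on_mult[OF continuous_on_mult[OF continuous_on_const g]
          C_infinity_continuous_on[OF \<open>C_infinity f\<close>]] in auto)
  then have "integrable lborel h"
    by (rule integrable_continuous_compact_support[of _ "cball a r"]) (auto simp: h_def f0)
  moreover have "h x \<ge> 0" for x
  proof (cases "x \<in> cball a r")
    case True
    then have "s * g x > 0" using r(2) by (auto simp: V_def)
    then show ?thesis by (simp add: h_def f(2))
  qed (simp add: h_def f0)
  moreover have "integral\<^sup>L lborel h = 0"
  proof -
    have "integral\<^sup>L lborel h = s * (LINT x:U|lborel. g x * f x)"
      unfolding h_def set_lebesgue_integral_def
      by (subst integral_mult_right_zero[symmetric]) (simp add: mult_ac)
    then show ?thesis
      using orth[OF f(1)] by simp
  qed
  ultimately have h0: "AE x in lborel. h x = 0"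
    using integral_nonneg_eq_0_iff_AE[of lborel h] by simp
  have h_pos: "h x > 0" if "x \<in> ball a r" for x
  proof -
    have "x \<in> V" using that r(2) ball_subset_cball by blast
    with that show ?thesis
      using f(3)[of x] by (simp add: h_def V_def)
  qed
  from h0 have "AE x in lborel. x \<notin> ball a r"
    by (rule eventually_mono) (metis h_pos less_irrefl)
  then have "ball a r \<in> null_sets lborel"
    by (subst AE_iff_null_sets) auto
  then have "negligible (ball a r)"
    using null_sets_completionI negligible_iff_null_sets by blast
  then show False
    using r(1) open_not_negligible[of "ball a r"] by simp
qed

lemma test_function_C_infinity: "test_function U f \<Longrightarrow> C_infinity f"
  by (simp add: test_function_def)

lemma eq_0_outside_closure_support: "x \<notin> closure {x. f x \<noteq> 0} \<Longrightarrow> f x = 0"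
  using closure_subset[of "{x. f x \<noteq> 0}"] by blast

text \<open>\<open>f\<close> is zero on the open complement of its support, and so is its
  derivative. This allows a partial derivative of \<open>f\<close> to serve as the test function
  when the curl is integrated by parts.\<close>

lemma test_function_partial_deriv:
  assumes "test_function U f"
  shows "test_function U (partial_deriv UNIV i f)"
proof -
  let ?K = "closure {x. f x \<noteq> 0}"
  have "partial_deriv UNIV i f x = 0" if "x \<notin> ?K" for x
  proof -
    have "(f has_derivative (\<lambda>_. 0)) (at x)"
      by (rule has_derivative_transform_within_open[where s="- ?K" and f="\<lambda>_. 0"])
        (use that in \<open>auto dest: eq_0_outside_closure_support\<close>)
    then have "frechet_derivative f (at x) = (\<lambda>_. 0)"
      by (rule frechet_derivative_at[symmetric])
    then show ?thesis
      by (simp add: partial_deriv_def)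
  qed
  then have "closure {x. partial_deriv UNIV i f x \<noteq> 0} \<subseteq> ?K"
    by (intro closure_minimal) auto
  moreover have "compact ?K" "?K \<subseteq> U"
    using assms by (simp_all add: test_function_def)
  ultimately show ?thesis
    using C_infinity_partial_deriv[of f i] test_function_C_infinity[OF assms]
    unfolding test_function_def compact_eq_bounded_closed
    by (meson bounded_subset closed_closure order_trans)
qed

text \<open>The second partial derivatives are again \<open>C_infinity\<close>, hence continuous, so
  the symmetry of second derivatives applies to the two coordinate directions.\<close>

lemma C_infinity_partial_derivs_commute:
  assumes "C_infinity f"
  shows "partial_deriv UNIV i (partial_deriv UNIV j f) x = partial_deriv UNIV j (partial_deriv UNIV i f) x"
proof -
  have p: "partial_deriv UNIV k g = (\<lambda>x. frechet_derivative g (at x) (axis k 1))" for k :: 'a and g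
    by (simp add: partial_deriv_def fun_eq_iff)
  note C = C_infinity_partial_deriv[OF assms]
  have 1: "(f has_derivative frechet_derivative f (at x)) (at x)" for x
    by (rule C_infinity_has_derivative[OF assms])
  have 2: "((\<lambda>x. frechet_derivative f (at x) (axis k 1)) has_derivative
      frechet_derivative (partial_deriv UNIV k f) (at x)) (at x)" for x k
    using C_infinity_has_derivative[OF C[of k]] by (simp add: p[of k f])
  have 3: "isCont (\<lambda>x. frechet_derivative (partial_deriv UNIV k f) (at x) (axis l 1)) x" for k l
    using C_infinity_continuous_on[OF C_infinity_partial_deriv[OF C[of k], of l], of UNIV]
    by (simp add: p[of l] continuous_on_eq_continuous_at)
  show ?thesis
    using second_derivatives_commute[OF 1 2 2 3 3] by (simp only: p)
qed

lemma test_function_integral_by_parts: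
  fixes u :: "real^'n \<Rightarrow> real"
  assumes U: "open U" and f: "test_function U f"
    and u: "\<And>x. x \<in> U \<Longrightarrow> (u has_derivative u' x) (at x)" "continuous_on U (\<lambda>x. u' x (axis i 1))"
  shows "set_integrable lborel U (\<lambda>x. u' x (axis i 1) * f x)" (is ?int1)
    and "set_integrable lborel U (\<lambda>x. u x * partial_deriv UNIV i f x)" (is ?int2)
    and "(LINT x:U|lborel. u' x (axis i 1) * f x) = - (LINT x:U|lborel. u x * partial_deriv UNIV i f x)" (is ?eq)
proof -
  let ?K = "closure {x. f x \<noteq> 0}"
  have p: "partial_deriv UNIV i f = (\<lambda>x. frechet_derivative f (at x) (axis i 1))"
    by (simp add: partial_deriv_def fun_eq_iff)
  have K: "compact ?K" "?K \<subseteq> U"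
    using f by (simp_all add: test_function_def)
  have df: "(f has_derivative frechet_derivative f (at x)) (at x)" for x
    by (rule C_infinity_has_derivative[OF test_function_C_infinity[OF f]])
  have cf: "continuous_on UNIV (\<lambda>x. frechet_derivative f (at x) (axis i 1))"
    using C_infinity_continuous_on[OF C_infinity_partial_deriv[OF test_function_C_infinity[OF f]], of UNIV i]
    by (simp only: p)
  note * = set_integral_by_parts_compact_support[where u = u and u' = u' and w = f
      and w' = "\<lambda>x. frechet_derivative f (at x)" and b = "axis i 1" and K = ?K and U = U,
      OF U K _ u(2) df cf eq_0_outside_closure_support[of _ f]]
  show ?int1
    by (rule *(1)) (rule u(1))
  show ?int2
    unfolding p by (rule *(2)) (rule u(1))
  show ?eq
    unfolding p by (rule *(3)) (rule u(1))
qed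

lemma set_integrable_mult_test_function:
  fixes g :: "real^'n \<Rightarrow> real"
  assumes U: "open U" and f: "test_function U f" and g: "continuous_on U g"
  shows "set_integrable lborel U (\<lambda>x. g x * f x)"
proof -
  let ?K = "closure {x. f x \<noteq> 0}"
  have K: "compact ?K" "?K \<subseteq> U"
    using f by (simp_all add: test_function_def)
  have "continuous_on UNIV (\<lambda>x. indicator U x *\<^sub>R (g x * f x))"
    by (rule continuous_on_zero_extension[OF U K(1) continuous_on_mult[OF g
          C_infinity_continuous_on[OF test_function_C_infinity[OF f]]]]) (use K in \<open>auto dest: eq_0_outside_closure_support\<close>)
  then show ?thesis
    unfolding set_integrable_def
    by (rule integrable_continuous_compact_support[OF _ K(1)]) (auto dest: eq_0_outside_closure_support)
qed

text \<open>The difference of two candidates is orthogonal to all test functions, so it vanishes in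
  the interior. Continuity carries this to the closure of the interior, which is all of
  \<open>T\<close> for a closed convex set with interior points, and outside \<open>T\<close> both
  are 0 by definition.\<close>

lemma weak_div_eqI:
  fixes F :: "real^'n \<Rightarrow> real^'n"
  assumes T: "convex T" "closed T" "interior T \<noteq> {}"
    and g: "continuous_on T g" "\<And>x. x \<notin> T \<Longrightarrow> g x = 0" "has_weak_div (interior T) F g"
  shows "weak_div T F = g"
  unfolding weak_div_def
proof (rule the_equality)
  fix h assume h: "continuous_on T h \<and> (\<forall>x. x \<notin> T \<longrightarrow> h x = 0) \<and> has_weak_div (interior T) F h"
  let ?U = "interior T"
  have cg: "continuous_on ?U g" and ch: "continuous_on ?U h"
    using g(1) h by (auto intro: continuous_on_subset[OF _ interior_subset])
  have 0: "h x - g x = 0" if "x \<in> ?U" for x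
  proof (rule eq_0_if_orthogonal_to_test_functions[OF open_interior _ _ that])
    show "continuous_on ?U (\<lambda>x. h x - g x)"
      by (intro continuous_on_diff cg ch)
    fix f :: "real^'n \<Rightarrow> real" assume f: "test_function ?U f"
    have "(LINT x:?U|lborel. h x * f x) = (LINT x:?U|lborel. g x * f x)"
      using g(3) h f unfolding has_weak_div_def by (metis (no_types, lifting) neg_equal_iff_equal)
    then show "(LINT x:?U|lborel. (h x - g x) * f x) = 0"
      using set_integral_diff(2)[OF set_integrable_mult_test_function[OF open_interior f ch]
          set_integrable_mult_test_function[OF open_interior f cg]]
      by (simp add: left_diff_distrib)
  qed
  have T': "closure ?U = T"
    using T by (simp add: convex_closure_interior)
  have "h x - g x = 0" if "x \<in> T" for x
  proof (rule continuous_constant_on_closure[of ?U "\<lambda>x. h x - g x"])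
    show "continuous_on (closure ?U) (\<lambda>x. h x - g x)"
      unfolding T' using g(1) h by (intro continuous_on_diff) auto
  qed (use 0 that T' in auto)
  then have "h x = g x" for x
    using g(2)[of x] h by (cases "x \<in> T") auto
  then show "h = g"
    by (rule ext)
qed (use g in auto)

section \<open>Derivatives within a convex set, and the curl\<close>

text \<open>The difference \<open>D\<close> of the two derivatives is a derivative of the zero
  function. Restricting to segments from \<open>x\<close> into \<open>T\<close> shows that
  \<open>D\<close> vanishes on \<open>y - x\<close> for all \<open>y\<close> in \<open>T\<close>.
  These vectors span the space because \<open>T\<close> contains a ball, even when \<open>x\<close>
  is a corner.\<close>

lemma has_derivative_within_convex_unique:
  fixes f :: "'a::real_normed_vector \<Rightarrow> 'b::real_normed_vector"
  assumes T: "convex T" "interior T \<noteq> {}" "x \<in> T"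
    and f: "(f has_derivative A) (at x within T)" "(f has_derivative B) (at x within T)"
  shows "A = B"
proof -
  define D where "D d = A d - B d" for d
  have D: "((\<lambda>_. 0) has_derivative D) (at x within T)"
    using has_derivative_diff[OF f] by (simp add: D_def[abs_def])
  then have lin: "linear D"
    by (rule has_derivative_linear)
  have D0: "D (y - x) = 0" if "y \<in> T" for y
  proof -
    have seg: "(\<lambda>s. x + s *\<^sub>R (y - x)) ` {0..1} \<subseteq> T"
      using T(1,3) that by (auto simp: convex_alt algebra_simps)
    have line: "((\<lambda>s. x + s *\<^sub>R (y - x)) has_derivative (\<lambda>d. d *\<^sub>R (y - x))) (at 0 within {0..1})"
      by (auto intro!: derivative_eq_intros)
    have "((\<lambda>_. 0) has_derivative D) (at (x + 0 *\<^sub>R (y - x)) within (\<lambda>s. x + s *\<^sub>R (y - x)) ` {0..1})"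
      using has_derivative_subset[OF D seg] by simp
    \<comment> \<open>Along the segment the zero function has derivative \<open>D (y - x)\<close> at
      the endpoint 0 of the unit interval, where a one-sided derivative is already unique.\<close>
    from has_derivative_in_compose[OF line this]
    have "((\<lambda>_. 0) has_vector_derivative D (y - x)) (at (0::real) within cbox 0 1)"
      by (simp add: has_vector_derivative_def linear_scale[OF lin])
    then show ?thesis
      by (rule vector_derivative_unique_within_closed_interval[rotated 2]) auto
  qed
  obtain z e where e: "e > 0" "ball z e \<subseteq> T"
    using T(2) by (auto simp: mem_interior)
  have "D w = 0" for w
  proof (cases "w = 0")
    case False
    \<comment> \<open>The factor puts \<open>y\<close> at distance \<open>e / 2\<close> from
      \<open>z\<close>, inside the ball, and makes \<open>y - z\<close> a positive multiple of
      \<open>w\<close>.\<close>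
    define y where "y = z + (e / (2 * norm w)) *\<^sub>R w"
    have "y \<in> ball z e" "z \<in> ball z e"
      using False e(1) by (simp_all add: y_def dist_norm)
    then have "D (y - x) - D (z - x) = 0"
      using D0[OF subsetD[OF e(2)]] by simp
    then have "D (y - z) = 0"
      by (simp add: linear_diff[OF lin])
    then show ?thesis
      using False e(1) by (simp add: y_def linear_scale[OF lin])
  qed (simp add: linear_0[OF lin])
  then show ?thesis
    by (simp add: D_def fun_eq_iff)
qed

text \<open>Vanishing outside \<open>T\<close> makes a member determined by its values on
  \<open>T\<close>, in agreement with \<open>on_set\<close>. The space contains all of
  \<open>M_Lambda0\<close>, and on it \<open>curl T\<close> is linear with kernel
  \<open>const_funs T\<close>.\<close>

definition C1_functions :: "(real^'n) set \<Rightarrow> (real^'n \<Rightarrow> real) set"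
  where "C1_functions T = {u. C1_on T u \<and> (\<forall>x. x \<notin> T \<longrightarrow> u x = 0)}"

lemma C1_on_has_derivative:
  assumes "C1_on T f" "x \<in> T"
  shows "(f has_derivative frechet_derivative f (at x within T)) (at x within T)"
  using assms by (simp add: C1_on_def differentiable_on_def frechet_derivative_works)

text \<open>\<open>frechet_derivative\<close> only chooses some derivative within \<open>T\<close>;
  uniqueness identifies the choice with the given \<open>f'\<close>. All rules for computing partial
  derivatives within \<open>T\<close> rest on this.\<close>

lemma partial_deriv_within_eqI:
  assumes "convex T" "interior T \<noteq> {}" "x \<in> T" "(f has_derivative f') (at x within T)"
  shows "partial_deriv T i f x = f' (axis i 1)"
proof -
  have "(f has_derivative frechet_derivative f (at x within T)) (at x within T)"
    using assms(4) by (metis differentiable_def frechet_derivative_works)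
  then have "frechet_derivative f (at x within T) = f'"
    using assms has_derivative_within_convex_unique by blast
  then show ?thesis
    by (simp add: partial_deriv_def)
qed

lemma C1_onI:
  assumes "\<And>x. x \<in> T \<Longrightarrow> f differentiable (at x within T)"
    and "\<And>i. continuous_on T (g i)" "\<And>i x. x \<in> T \<Longrightarrow> partial_deriv T i f x = g i x"
  shows "C1_on T f"
  using assms continuous_on_eq unfolding C1_on_def differentiable_on_def by (metis (no_types, lifting))

lemma partial_deriv_within_add:
  assumes "convex T" "interior T \<noteq> {}" "x \<in> T" "C1_on T f" "C1_on T g"
  shows "partial_deriv T i (f + g) x = partial_deriv T i f x + partial_deriv T i g x"
  using partial_deriv_within_eqI[OF assms(1-3) has_derivative_add[OF
        C1_on_has_derivative[OF assms(4,3)] C1_on_has_derivative[OF assms(5,3)]], of i]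
  by (simp add: plus_fun_def partial_deriv_def)

lemma partial_deriv_within_scaleR:
  assumes "convex T" "interior T \<noteq> {}" "x \<in> T" "C1_on T f"
  shows "partial_deriv T i (c *\<^sub>R f) x = c * partial_deriv T i f x"
  using partial_deriv_within_eqI[OF assms(1-3) has_derivative_scaleR_right[OF
        C1_on_has_derivative[OF assms(4,3)]], of i c]
  by (simp add: scaleR_fun_def partial_deriv_def)

lemma partial_deriv_within_const:
  assumes "convex T" "interior T \<noteq> {}" "x \<in> T" "\<And>y. y \<in> T \<Longrightarrow> f y = c"
  shows "partial_deriv T i f x = 0"
proof -
  have "(f has_derivative (\<lambda>_. 0)) (at x within T)"
    by (rule has_derivative_transform[OF assms(3,4) has_derivative_const])
  from partial_deriv_within_eqI[OF assms(1-3) this] show ?thesis .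
qed

lemma subspace_C1_functions:
  assumes T: "convex T" "interior T \<noteq> {}"
  shows "subspace (C1_functions T)"
proof (rule subspaceI)
  have "C1_on T 0"
    by (rule C1_onI[where g = "\<lambda>_ _. 0"])
       (auto simp: zero_fun_def partial_deriv_within_const[OF T])
  then show "0 \<in> C1_functions T"
    by (simp add: C1_functions_def)
next
  fix f g assume fg: "f \<in> C1_functions T" "g \<in> C1_functions T"
  then have *: "C1_on T f" "C1_on T g"
    by (simp_all add: C1_functions_def)
  have "C1_on T (f + g)"
  proof (rule C1_onI[where g = "\<lambda>i x. partial_deriv T i f x + partial_deriv T i g x"])
    show "f + g differentiable at x within T" if "x \<in> T" for x
      using * that unfolding plus_fun_def C1_on_def differentiable_on_def by auto
  qed (use * partial_deriv_within_add[OF T] in \<open>auto simp: C1_on_def intro: continuous_on_add\<close>)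
  then show "f + g \<in> C1_functions T"
    using fg by (simp add: C1_functions_def)
next
  fix f c assume f: "f \<in> C1_functions T"
  then have *: "C1_on T f"
    by (simp add: C1_functions_def)
  have "C1_on T (c *\<^sub>R f)"
  proof (rule C1_onI[where g = "\<lambda>i x. c * partial_deriv T i f x"])
    show "c *\<^sub>R f differentiable at x within T" if "x \<in> T" for x
      using * that unfolding scaleR_fun_def C1_on_def differentiable_on_def by auto
  qed (use * partial_deriv_within_scaleR[OF T] in \<open>auto simp: C1_on_def intro: continuous_on_mult_left\<close>)
  then show "c *\<^sub>R f \<in> C1_functions T"
    using f by (simp add: C1_functions_def scaleR_fun_def)
qed

lemma
  assumes T: "convex T" "interior T \<noteq> {}" and f: "C1_on T f"
  shows on_set_in_C1_functions: "on_set T f \<in> C1_functions T"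
    and partial_deriv_on_set: "x \<in> T \<Longrightarrow> partial_deriv T i (on_set T f) x = partial_deriv T i f x"
proof -
  have d: "(on_set T f has_derivative frechet_derivative f (at x within T)) (at x within T)" if "x \<in> T" for x
    by (rule has_derivative_transform[OF that _ C1_on_has_derivative[OF f that]]) (simp add: on_set_def)
  show p: "partial_deriv T i (on_set T f) x = partial_deriv T i f x" if "x \<in> T" for x i
    using partial_deriv_within_eqI[OF T that d[OF that]] by (simp add: partial_deriv_def)
  have "C1_on T (on_set T f)"
    by (rule C1_onI[where g = "\<lambda>i. partial_deriv T i f"])
       (use f d p in \<open>auto simp: C1_on_def differentiable_def\<close>)
  then show "on_set T f \<in> C1_functions T"
    by (simp add: C1_functions_def on_set_def)
qed

lemma curl_on_set:
  assumes "convex T" "interior T \<noteq> {}" "C1_on T f"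
  shows "curl T (on_set T f) = curl T f"
  using partial_deriv_on_set[OF assms] by (auto simp: curl_def on_set_def)

lemma const_funs_subset_C1_functions:
  assumes T: "convex T" "interior T \<noteq> {}"
  shows "const_funs T \<subseteq> C1_functions T"
proof -
  have "C1_on T (\<lambda>_. c)" for c :: real
    by (rule C1_onI[where g = "\<lambda>_ _. 0"]) (auto simp: partial_deriv_within_const[OF T])
  then show ?thesis
    using on_set_in_C1_functions[OF T] by (auto simp: const_funs_def)
qed

lemma subspace_const_funs: "subspace (const_funs T)"
  for T :: "'a set"
proof (rule subspaceI)
  show "0 \<in> const_funs T"
    by (auto simp: const_funs_def on_set_def fun_eq_iff intro!: image_eqI[of _ _ 0])
next
  fix f g :: "'a \<Rightarrow> 'b" assume "f \<in> const_funs T" "g \<in> const_funs T"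
  then obtain c d where "f = on_set T (\<lambda>_. c)" "g = on_set T (\<lambda>_. d)"
    by (auto simp: const_funs_def)
  then have "f + g = on_set T (\<lambda>_. c + d)"
    by (auto simp: on_set_def)
  then show "f + g \<in> const_funs T"
    by (auto simp: const_funs_def)
next
  fix f :: "'a \<Rightarrow> 'b" and k assume "f \<in> const_funs T"
  then obtain c where "f = on_set T (\<lambda>_. c)"
    by (auto simp: const_funs_def)
  then have "k *\<^sub>R f = on_set T (\<lambda>_. k *\<^sub>R c)"
    by (auto simp: on_set_def scaleR_fun_def)
  then show "k *\<^sub>R f \<in> const_funs T"
    by (auto simp: const_funs_def)
qed

lemma linear_between_curl:
  assumes T: "convex T" "interior T \<noteq> {}"
  shows "linear_between (C1_functions T) (curl T) UNIV"
  unfolding linear_between_def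
proof (intro conjI ballI allI subspace_C1_functions[OF T] subspace_UNIV subset_UNIV)
  fix u w assume "u \<in> C1_functions T" "w \<in> C1_functions T"
  then show "curl T (u + w) = curl T u + curl T w"
    using partial_deriv_within_add[OF T]
    by (auto simp: C1_functions_def curl_def on_set_def fun_eq_iff vec_eq_iff forall_2)
next
  fix u c assume "u \<in> C1_functions T"
  then show "curl T (c *\<^sub>R u) = c *\<^sub>R curl T u"
    using partial_deriv_within_scaleR[OF T]
    \<comment> \<open>The instance of \<open>scaleR_fun_def\<close> unfolds scaling of vector-valued
      functions only; \<open>c *\<^sub>R u\<close> with real-valued \<open>u\<close> must stay
      folded for \<open>partial_deriv_within_scaleR\<close> to apply.\<close>
    by (auto simp: C1_functions_def curl_def on_set_def scaleR_fun_def[of c "\<lambda>x. (_ x :: real^2)"] fun_eq_iff vec_eq_iff forall_2)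
qed

lemma curl_eq_0_iff:
  assumes T: "convex T" "interior T \<noteq> {}" and u: "u \<in> C1_functions T"
  shows "curl T u = 0 \<longleftrightarrow> u \<in> const_funs T"
proof
  assume "u \<in> const_funs T"
  then obtain c where "u = on_set T (\<lambda>_. c)"
    by (auto simp: const_funs_def)
  then have "partial_deriv T i u x = 0" if "x \<in> T" for i x
    using that by (intro partial_deriv_within_const[OF T]) (auto simp: on_set_def)
  then show "curl T u = 0"
    by (auto simp: curl_def on_set_def fun_eq_iff vec_eq_iff forall_2)
next
  assume 0: "curl T u = 0"
  have C1: "C1_on T u"
    using u by (simp add: C1_functions_def)
  have "(u has_derivative (\<lambda>_. 0)) (at x within T)" if x: "x \<in> T" for x
  proof -
    let ?D = "frechet_derivative u (at x within T)"
    note D = C1_on_has_derivative[OF C1 x]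
    have "vector [- partial_deriv T 2 u x, partial_deriv T 1 u x] = (0 :: real^2)"
      using fun_cong[OF 0, of x] x by (simp add: curl_def on_set_def)
    then have "?D (axis 1 1) = 0" "?D (axis 2 1) = 0"
      by (simp_all add: vec_eq_iff forall_2 partial_deriv_def)
    moreover have "d = d $ 1 *\<^sub>R axis 1 1 + d $ 2 *\<^sub>R axis 2 1" for d :: "real^2"
      by (simp add: vec_eq_iff forall_2 axis_def)
    ultimately have "?D d = 0" for d
      using linear_add[OF has_derivative_linear[OF D]] linear_scale[OF has_derivative_linear[OF D]]
      by (metis add.right_neutral scaleR_zero_right)
    then have "?D = (\<lambda>_. 0)"
      by (rule ext)
    with D show ?thesis
      by simp
  qed
  from has_derivative_zero_constant[OF T(1) this]
  obtain c where "\<And>x. x \<in> T \<Longrightarrow> u x = c"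
    by auto
  then have "u = on_set T (\<lambda>_. c)"
    using u by (auto simp: on_set_def C1_functions_def)
  then show "u \<in> const_funs T"
    by (auto simp: const_funs_def)
qed

section \<open>Weak divergence of a curl plus a radial field\<close>

lemma has_weak_div_curl_plus_radial:
  assumes T: "convex T" "interior T \<noteq> {}" and u: "C1_on T u"
  shows "has_weak_div (interior T) (curl T u + c *\<^sub>R on_set T (\<lambda>x. x - xs)) (on_set T (\<lambda>_. 2 * c))"
proof -
  let ?U = "interior T"
  let ?F = "curl T u + c *\<^sub>R on_set T (\<lambda>x. x - xs)"
  define D where "D x = frechet_derivative u (at x within T)" for x
  have F: "?F x = vector [- D x (axis 2 1), D x (axis 1 1)] + c *\<^sub>R (x - xs)" if "x \<in> T" for x
    using that by (simp add: curl_def on_set_def D_def partial_deriv_def scaleR_fun_def)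
  have cont: "continuous_on T (\<lambda>x. D x (axis i 1))" for i
    using u by (simp add: C1_on_def partial_deriv_def[abs_def] D_def)
  have contU: "continuous_on ?U (\<lambda>x. D x (axis i 1))" for i
    by (rule continuous_on_subset[OF cont interior_subset])
  have contF: "continuous_on T ?F"
  proof -
    \<comment> \<open>Writing the vector as a function of its index allows continuity to be checked
      in each component.\<close>
    have "continuous_on T (\<lambda>x. (\<chi> i. if i = 1 then - D x (axis 2 1) else D x (axis 1 1)) + c *\<^sub>R (x - xs))"
    proof (intro continuous_on_add continuous_on_vec_lambda)
      show "continuous_on T (\<lambda>x. if i = 1 then - D x (axis 2 1) else D x (axis 1 1))" for i :: 2
        by (cases "i = 1") (auto intro!: continuous_on_minus cont)
    qed (intro continuous_intros)
    then show ?thesis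
      by (rule continuous_on_eq) (simp only: F, simp add: vec_eq_iff forall_2)
  qed
  have dU: "(u has_derivative D x) (at x)" if "x \<in> ?U" for x
    using C1_on_has_derivative[OF u subsetD[OF interior_subset that]]
    by (simp add: D_def at_within_interior[OF that])
  have dcoord: "((\<lambda>x. x $ i - xs $ i) has_derivative (\<lambda>d. d $ i)) (at x)" for i x
    by (auto intro!: derivative_eq_intros bounded_linear_imp_has_derivative)
  show ?thesis
    unfolding has_weak_div_def
  proof (intro conjI allI impI)
    fix K assume K: "compact K \<and> K \<subseteq> ?U"
    then have "K \<subseteq> T"
      using interior_subset by blast
    then show "set_integrable lborel K ?F"
      unfolding set_integrable_def using K
      by (intro borel_integrable_compact continuous_on_subset[OF contF]) auto
    have "continuous_on K (on_set T (\<lambda>_. 2 * c))"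
      using \<open>K \<subseteq> T\<close> by (intro continuous_on_eq[OF continuous_on_const[of K "2 * c"]]) (auto simp: on_set_def)
    then show "set_integrable lborel K (on_set T (\<lambda>_. 2 * c))"
      unfolding set_integrable_def using K by (intro borel_integrable_compact) auto
  next
    fix f :: "real^2 \<Rightarrow> real" assume f: "test_function ?U f"
    let ?f = "\<lambda>i. partial_deriv UNIV i f"
    define P Q R where "P = (\<lambda>x. D x (axis 2 1) * ?f 1 x)" and "Q = (\<lambda>x. D x (axis 1 1) * ?f 2 x)"
      and "R = (\<lambda>i x. (x $ i - xs $ i) * ?f i x)"
    \<comment> \<open>The test function here is the partial derivative \<open>?f i\<close>, so the
      one derivative that \<open>u\<close> has moves onto it and a second derivative of
      \<open>f\<close> results.\<close>
    have curl: "set_integrable lborel ?U (\<lambda>x. D x (axis j 1) * ?f i x)"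
      "(LINT x:?U|lborel. D x (axis j 1) * ?f i x) = - (LINT x:?U|lborel. u x * partial_deriv UNIV j (?f i) x)" for i j
      by (rule test_function_integral_by_parts[where u = u and u' = D, OF open_interior test_function_partial_deriv[OF f] dU contU], assumption)+
    have PQ: "set_integrable lborel ?U P" "set_integrable lborel ?U Q"
      unfolding P_def Q_def by (rule curl(1))+
    have PQ_eq: "(LINT x:?U|lborel. P x) = (LINT x:?U|lborel. Q x)"
      unfolding P_def Q_def curl(2)
      by (simp add: C_infinity_partial_derivs_commute[OF test_function_C_infinity[OF f], of 1 2])
    \<comment> \<open>The derivative of the \<open>i\<close>-th coordinate along its own axis is 1.
      Each of the two coordinates thus contributes one integral of \<open>f\<close>, which is where
      the factor 2 originates.\<close>
    have R: "set_integrable lborel ?U (R i)" "(LINT x:?U|lborel. R i x) = - (LINT x:?U|lborel. f x)" for i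
      using test_function_integral_by_parts(2,3)[where u = "\<lambda>x. x $ i - xs $ i" and u' = "\<lambda>_ d. d $ i" and i = i,
          OF open_interior f dcoord continuous_on_const]
      by (simp_all add: R_def)
    have "(LINT x:?U|lborel. ?F x \<bullet> (\<chi> i. ?f i x)) = (LINT x:?U|lborel. (Q x - P x) + c * (R 1 x + R 2 x))"
    proof (intro set_lebesgue_integral_cong allI impI)
      fix x assume "x \<in> ?U"
      then have "x \<in> T"
        using interior_subset by blast
      then show "?F x \<bullet> (\<chi> i. ?f i x) = (Q x - P x) + c * (R 1 x + R 2 x)"
        by (simp only: F) (simp add: P_def Q_def R_def inner_vec_def sum_2 algebra_simps)
    qed simp
    also have "\<dots> = ((LINT x:?U|lborel. Q x) - (LINT x:?U|lborel. P x)) +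
        c * ((LINT x:?U|lborel. R 1 x) + (LINT x:?U|lborel. R 2 x))"
      using PQ R(1) by (simp add: set_integral_add set_integral_diff)
    also have "\<dots> = - (2 * c * (LINT x:?U|lborel. f x))"
      using PQ_eq R(2) by simp
    also have "2 * c * (LINT x:?U|lborel. f x) = (LINT x:?U|lborel. 2 * c * f x)"
      by simp
    also have "\<dots> = (LINT x:?U|lborel. on_set T (\<lambda>_. 2 * c) x * f x)"
      using interior_subset[of T] by (intro set_lebesgue_integral_cong) (auto simp: on_set_def)
    finally show "(LINT x:?U|lborel. ?F x \<bullet> (\<chi> i. ?f i x)) = - (LINT x:?U|lborel. on_set T (\<lambda>_. 2 * c) x * f x)" .
  qed
qed

section \<open>Maps that are linear on a subspace, and independent families\<close>

lemma sum_fun_apply: "(\<Sum>i\<in>I. f i) x = (\<Sum>i\<in>I. f i x)"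
  by (induction I rule: infinite_finite_induct) auto

lemma linear_between_0: "linear_between V f W \<Longrightarrow> f 0 = 0"
  unfolding linear_between_def using subspace_0[of V] by (metis scaleR_zero_left)

text \<open>Linearity of \<open>curl T\<close> is available on C1 functions only, not on the whole
  function type, so sums and spans are handled relative to the subspace \<open>V\<close>.\<close>

lemma linear_between_sum:
  assumes f: "linear_between V f W" and "finite I" "\<And>i. i \<in> I \<Longrightarrow> e i \<in> V"
  shows "f (\<Sum>i\<in>I. c i *\<^sub>R e i) = (\<Sum>i\<in>I. c i *\<^sub>R f (e i))"
  using assms(2,3)
proof (induction I rule: finite_induct)
  case (insert i I)
  have V: "subspace V"
    using f by (simp add: linear_between_def)
  have "c i *\<^sub>R e i \<in> V" "(\<Sum>j\<in>I. c j *\<^sub>R e j) \<in> V"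
    using insert.prems by (auto intro!: subspace_sum subspace_scale V)
  then show ?case
    using f insert by (simp add: linear_between_def)
qed (simp add: linear_between_0[OF f])

lemma linear_between_mono:
  assumes "linear_between V f W" "subspace V'" "V' \<subseteq> V" "subspace W'" "f ` V' \<subseteq> W'"
  shows "linear_between V' f W'"
  using assms by (auto simp: linear_between_def subset_iff)

lemma linear_between_span_image:
  assumes f: "linear_between V f W" and B: "B \<subseteq> V"
  shows "f ` span B = span (f ` B)"
proof
  have V: "subspace V"
    using f by (simp add: linear_between_def)
  then have spanV: "span B \<subseteq> V"
    using B span_minimal by blast
  have "span B \<subseteq> {x \<in> V. f x \<in> span (f ` B)}"
  proof (rule span_minimal)
    show "subspace {x \<in> V. f x \<in> span (f ` B)}"
      using f V linear_between_0[OF f]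
      by (auto simp: subspace_def linear_between_def span_zero span_add span_scale)
  qed (use B in \<open>auto intro: span_base\<close>)
  then show "f ` span B \<subseteq> span (f ` B)"
    by auto
  show "span (f ` B) \<subseteq> f ` span B"
  proof (rule span_minimal)
    show "f ` B \<subseteq> f ` span B"
      using span_superset by blast
    show "subspace (f ` span B)"
    proof (rule subspaceI)
      show "0 \<in> f ` span B"
        using linear_between_0[OF f] span_zero by (metis imageI)
    next
      fix y z assume "y \<in> f ` span B" "z \<in> f ` span B"
      then obtain a b where "y = f a" "a \<in> span B" "z = f b" "b \<in> span B"
        by auto
      moreover from this have "f (a + b) = f a + f b"
        using f spanV by (simp add: linear_between_def subset_iff)
      ultimately show "y + z \<in> f ` span B"
        using span_add by (metis imageI)
    next
      fix y c assume "y \<in> f ` span B"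
      then obtain a where "y = f a" "a \<in> span B"
        by auto
      moreover from this have "f (c *\<^sub>R a) = c *\<^sub>R f a"
        using f spanV by (simp add: linear_between_def subset_iff)
      ultimately show "c *\<^sub>R y \<in> f ` span B"
        using span_scale by (metis imageI)
    qed
  qed
qed

text \<open>Independence of the image set alone would not exclude repetitions, and counting
  dimensions requires injectivity as well. Both come from the same hypothesis: if
  \<open>e i = e j\<close> for distinct indices, the coefficients 1 and -1 give a nontrivial
  vanishing combination.\<close>

lemma linearly_independent_family:
  fixes e :: "'i \<Rightarrow> 'a::real_vector"
  assumes "finite I" and zero: "\<And>c i. (\<Sum>j\<in>I. c j *\<^sub>R e j) = 0 \<Longrightarrow> i \<in> I \<Longrightarrow> c i = 0"
  shows "inj_on e I" "independent (e ` I)"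
proof -
  show inj: "inj_on e I"
  proof (rule inj_onI, rule ccontr)
    fix i j assume ij: "i \<in> I" "j \<in> I" "e i = e j" "i \<noteq> j"
    let ?c = "\<lambda>k. if k = i then 1 else if k = j then - 1 else (0::real)"
    have "(\<Sum>k\<in>I. ?c k *\<^sub>R e k) = (\<Sum>k\<in>{i, j}. ?c k *\<^sub>R e k)"
      using assms(1) ij by (intro sum.mono_neutral_right) auto
    also have "\<dots> = 0"
      using ij by simp
    finally show False
      using zero[of ?c i] ij by simp
  qed
  show "independent (e ` I)"
  proof (rule independent_if_scalars_zero)
    fix f x assume f: "(\<Sum>x\<in>e ` I. f x *\<^sub>R x) = 0" and "x \<in> e ` I"
    then obtain i where "i \<in> I" "x = e i"
      by auto
    then show "f x = 0"
      using f zero[of "\<lambda>i. f (e i)" i] by (simp add: sum.reindex[OF inj])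
  qed (use assms(1) in simp)
qed

section \<open>Exactness and dimensions\<close>

theorem mainTheorem1:
  fixes T :: "(real^2) set" and n :: nat and v :: "nat \<Rightarrow> real^2"
    and lam :: "nat \<Rightarrow> real^2 \<Rightarrow> real" and xs :: "real^2"
  assumes "convex_polygon T n v"
    and "gen_barycentric T n v lam"
    and "\<And>i j. i \<in> {1..n} \<Longrightarrow> j \<in> {1..n} \<Longrightarrow> lam i (v j) = (if i = j then 1 else 0)"
    and "\<And>i e. i \<in> {1..n} \<Longrightarrow> e edge_of T \<Longrightarrow> \<exists>L. affine_fun L \<and> (\<forall>x\<in>e. lam i x = L x)"
    and "\<And>i. i \<in> {1..n} \<Longrightarrow> C1_on T (lam i)"
    and "xs \<in> interior T"
  shows "(\<forall>F \<in> chi_M_Lambda1 T n lam xs. has_weak_div (interior T) F (weak_div T F))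
    \<and> exact_at {0 :: real} (\<lambda>_. 0) (const_funs T) id (M_Lambda0 T n lam)
    \<and> exact_at (const_funs T) id (M_Lambda0 T n lam) (curl T) (chi_M_Lambda1 T n lam xs)
    \<and> exact_at (M_Lambda0 T n lam) (curl T) (chi_M_Lambda1 T n lam xs) (weak_div T)
        (const_funs T)
    \<and> exact_at (chi_M_Lambda1 T n lam xs) (weak_div T) (const_funs T) (\<lambda>_. 0) {0 :: real}
    \<and> dim (M_Lambda0 T n lam) = n
    \<and> dim (chi_M_Lambda1 T n lam xs) = n"
proof -
  have T: "convex T" "interior T \<noteq> {}" and "closed T"
    using assms(1) by (auto simp: convex_polygon_def polytope_imp_convex polytope_imp_closed)
  have "xs \<in> T"
    using assms(6) interior_subset by blast
  have vT: "v i \<in> T" if "i \<in> {1..n}" for i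
    using assms(1) that by (auto simp: convex_polygon_def bij_betw_def extreme_point_of_def)
  define e where "e i = on_set T (lam i)" for i
  define R where "R = on_set T (\<lambda>x. x - xs)"
  let ?M = "M_Lambda0 T n lam" and ?X = "chi_M_Lambda1 T n lam xs"
  have M: "?M = span (e ` {1..n})"
    by (simp add: M_Lambda0_def e_def)
  have eC1: "e i \<in> C1_functions T" if "i \<in> {1..n}" for i
    unfolding e_def by (rule on_set_in_C1_functions[OF T assms(5)[OF that]])
  then have MC1: "?M \<subseteq> C1_functions T"
    unfolding M by (intro span_minimal subspace_C1_functions T) auto
  note lin = linear_between_curl[OF T]
  have subM: "subspace ?M"
    by (simp add: M)
  have curlM: "curl T ` ?M = span ((\<lambda>i. curl T (e i)) ` {1..n})"
  proof -
    have "e ` {1..n} \<subseteq> C1_functions T"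
      using eC1 by blast
    from linear_between_span_image[OF lin this] show ?thesis
      by (simp only: M image_image)
  qed
  \<comment> \<open>\<open>chi_M_Lambda1\<close> is generated by curls of the given
    \<open>lam i\<close>, whereas \<open>M_Lambda0\<close> is generated by their extensions by zero;
    the two curls agree.\<close>
  have curl_e: "curl T (lam i) = curl T (e i)" if "i \<in> {1..n}" for i
    unfolding e_def by (rule curl_on_set[OF T assms(5)[OF that], symmetric])
  have X_eq: "?X = {F + G | F G. F \<in> curl T ` ?M \<and> G \<in> range (\<lambda>c. c *\<^sub>R R)}"
  proof -
    have "(\<lambda>i. curl T (lam i)) ` {1..n} = (\<lambda>i. curl T (e i)) ` {1..n}"
      using curl_e by (intro image_cong) auto
    then show ?thesis
      unfolding curlM by (simp add: chi_M_Lambda1_def span_singleton R_def)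
  qed
  have X_iff: "F \<in> ?X \<longleftrightarrow> (\<exists>u\<in>?M. \<exists>c. F = curl T u + c *\<^sub>R R)" for F
    unfolding X_eq by auto
  have X_span: "?X = span ((\<lambda>i. curl T (e i)) ` {1..n} \<union> {R})"
    unfolding span_Un curlM[symmetric] span_singleton by (rule X_eq)
  then have subX: "subspace ?X"
    by simp
  have div: "has_weak_div (interior T) (curl T u + c *\<^sub>R R) (on_set T (\<lambda>_. 2 * c))"
    "weak_div T (curl T u + c *\<^sub>R R) = on_set T (\<lambda>_. 2 * c)" if "u \<in> ?M" for u c
  proof -
    show *: "has_weak_div (interior T) (curl T u + c *\<^sub>R R) (on_set T (\<lambda>_. 2 * c))"
      unfolding R_def using MC1 that
      by (intro has_weak_div_curl_plus_radial[OF T]) (auto simp: C1_functions_def)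
    show "weak_div T (curl T u + c *\<^sub>R R) = on_set T (\<lambda>_. 2 * c)"
    proof (rule weak_div_eqI[OF T(1) \<open>closed T\<close> T(2) _ _ *])
      show "continuous_on T (on_set T (\<lambda>_. 2 * c))"
        by (rule continuous_on_eq[OF continuous_on_const]) (simp add: on_set_def)
    qed (simp add: on_set_def)
  qed
  have on_set_eq_0: "on_set T (\<lambda>_. c) = 0 \<longleftrightarrow> c = 0" for c :: real
    using \<open>xs \<in> T\<close> by (auto simp: on_set_def fun_eq_iff)
  have sum_e: "on_set T (\<lambda>_. c) = (\<Sum>i=1..n. c *\<^sub>R e i)" for c
  proof
    fix x
    \<comment> \<open>Linear precision for the constant function 1 yields the partition of
      unity.\<close>
    have "affine_fun (\<lambda>_. 1)"
      unfolding affine_fun_def by (rule exI[of _ "\<lambda>_. 0"]) (auto simp: linear_iff)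
    then have "1 = (\<Sum>i=1..n. lam i x)" if "x \<in> T"
      using assms(2) that unfolding gen_barycentric_def by fastforce
    then show "on_set T (\<lambda>_. c) x = (\<Sum>i=1..n. c *\<^sub>R e i) x"
      by (auto simp: on_set_def e_def scaleR_fun_def sum_distrib_left[symmetric] sum_fun_apply)
  qed
  have constM: "const_funs T \<subseteq> ?M"
    unfolding const_funs_def M sum_e
    by (intro image_subsetI span_sum) (intro span_scale span_base imageI)
  have e_v: "(\<Sum>i=1..n. c i *\<^sub>R e i) (v j) = c j" if "j \<in> {1..n}" for c j
  proof -
    have "(\<Sum>i=1..n. c i *\<^sub>R e i) (v j) = (\<Sum>i=1..n. c i * lam i (v j))"
      using vT[OF that] by (simp add: e_def on_set_def scaleR_fun_def sum_fun_apply)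
    also have "\<dots> = (\<Sum>i=1..n. if i = j then c i else 0)"
      using assms(3) that by (intro sum.cong) auto
    finally show ?thesis
      using that by simp
  qed
  \<comment> \<open>For \<open>n = 0\<close> the constant 1 on the nonempty set \<open>T\<close>
    would be an empty sum.\<close>
  have n: "1 \<in> {1..n}"
    using on_set_eq_0[of 1] sum_e[of 1] by (cases n) auto

  have "\<forall>F\<in>?X. has_weak_div (interior T) F (weak_div T F)"
    using div by (auto simp: X_iff)
  moreover have exact1: "exact_at {0 :: real} (\<lambda>_. 0) (const_funs T) id ?M"
    using subM constM subspace_const_funs[of T] subspace_0[OF subspace_const_funs[of T]]
    by (auto simp: exact_at_def linear_between_def subspace_single_0)
  moreover have exact2: "exact_at (const_funs T) id ?M (curl T) ?X"
    unfolding exact_at_def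
  proof (intro conjI)
    show "linear_between (const_funs T) id ?M"
      using exact1 by (simp add: exact_at_def)
    show "linear_between ?M (curl T) ?X"
    proof (rule linear_between_mono[OF lin subM MC1 subX])
      show "curl T ` ?M \<subseteq> ?X"
        using X_iff by (force intro: exI[of _ 0])
    qed
    show "id ` const_funs T = {x \<in> ?M. curl T x = 0}"
      using curl_eq_0_iff[OF T] MC1 constM by auto
  qed
  moreover have exact3: "exact_at ?M (curl T) ?X (weak_div T) (const_funs T)"
    unfolding exact_at_def
  proof (intro conjI)
    show linM: "linear_between ?M (curl T) ?X"
      using exact2 by (simp add: exact_at_def)
    show "linear_between ?X (weak_div T) (const_funs T)"
      unfolding linear_between_def
    proof (intro conjI ballI allI subX subspace_const_funs)
      show "weak_div T ` ?X \<subseteq> const_funs T"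
        using div(2) by (auto simp: X_iff const_funs_def)
    next
      \<comment> \<open>Additivity is not visible from a definite description; it is obtained by
        adding decompositions of \<open>F\<close> and \<open>G\<close> and reading off the
        constants.\<close>
      fix F G assume "F \<in> ?X" "G \<in> ?X"
      then obtain u c w d where uw: "u \<in> ?M" "w \<in> ?M" and F: "F = curl T u + c *\<^sub>R R" "G = curl T w + d *\<^sub>R R"
        by (auto simp: X_iff)
      have "curl T (u + w) = curl T u + curl T w"
        using linM uw by (simp add: linear_between_def)
      then have "F + G = curl T (u + w) + (c + d) *\<^sub>R R"
        by (simp add: F scaleR_left_distrib)
      then have "weak_div T (F + G) = on_set T (\<lambda>_. 2 * (c + d))"
        using div(2)[OF subspace_add[OF subM uw]] by simp
      then show "weak_div T (F + G) = weak_div T F + weak_div T G"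
        by (auto simp: F div(2)[OF uw(1)] div(2)[OF uw(2)] on_set_def)
    next
      fix F k assume "F \<in> ?X"
      then obtain u c where u: "u \<in> ?M" and F: "F = curl T u + c *\<^sub>R R"
        by (auto simp: X_iff)
      have "curl T (k *\<^sub>R u) = k *\<^sub>R curl T u"
        using linM u by (simp add: linear_between_def)
      then have "k *\<^sub>R F = curl T (k *\<^sub>R u) + (k * c) *\<^sub>R R"
        by (simp add: F scaleR_right_distrib)
      then have kF: "weak_div T (k *\<^sub>R F) = on_set T (\<lambda>_. 2 * (k * c))"
        using div(2)[OF subspace_scale[OF subM u]] by simp
      show "weak_div T (k *\<^sub>R F) = k *\<^sub>R weak_div T F"
        unfolding kF unfolding F div(2)[OF u] by (auto simp: on_set_def scaleR_fun_def)
    qed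
    show "curl T ` ?M = {x \<in> ?X. weak_div T x = 0}"
    proof (intro equalityI subsetI)
      fix F assume "F \<in> curl T ` ?M"
      then obtain u where u: "u \<in> ?M" and F: "F = curl T u + 0 *\<^sub>R R"
        by auto
      have "weak_div T F = 0"
        unfolding F div(2)[OF u] using on_set_eq_0[of 0] by simp
      moreover have "F \<in> ?X"
        unfolding X_iff using u F by blast
      ultimately show "F \<in> {x \<in> ?X. weak_div T x = 0}"
        by simp
    next
      fix F assume "F \<in> {x \<in> ?X. weak_div T x = 0}"
      then obtain u c where "u \<in> ?M" "F = curl T u + c *\<^sub>R R" "weak_div T F = 0"
        by (auto simp: X_iff)
      then show "F \<in> curl T ` ?M"
        using div(2)[of u c] on_set_eq_0[of "2 * c"] by auto
    qed
  qed
  moreover have "exact_at ?X (weak_div T) (const_funs T) (\<lambda>_. 0) {0 :: real}"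
    unfolding exact_at_def
  proof (intro conjI)
    show "linear_between ?X (weak_div T) (const_funs T)"
      using exact3 by (simp add: exact_at_def)
    then have "weak_div T ` ?X \<subseteq> const_funs T"
      by (simp add: linear_between_def)
    moreover have "on_set T (\<lambda>_. c) \<in> weak_div T ` ?X" for c
    proof (rule image_eqI)
      \<comment> \<open>The coefficient \<open>c / 2\<close> compensates for the divergence 2 of
        \<open>R\<close>.\<close>
      show "on_set T (\<lambda>_. c) = weak_div T (curl T 0 + (c / 2) *\<^sub>R R)"
        using div(2)[OF subspace_0[OF subM], of "c / 2"] by simp
      show "curl T 0 + (c / 2) *\<^sub>R R \<in> ?X"
        using subspace_0[OF subM] X_iff by blast
    qed
    ultimately show "weak_div T ` ?X = {x \<in> const_funs T. (0::real) = 0}"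
      by (auto simp: const_funs_def)
  qed (auto simp: linear_between_def subspace_const_funs subspace_single_0)
  moreover have "dim ?M = n"
  proof -
    have zero: "c i = 0" if "(\<Sum>j=1..n. c j *\<^sub>R e j) = 0" "i \<in> {1..n}" for c i
      using e_v[OF that(2), of c] that(1) by simp
    have "inj_on e {1..n}" "independent (e ` {1..n})"
      by (rule linearly_independent_family[where e = e], simp, erule zero, assumption)+
    then show ?thesis
      by (simp add: M dim_eq_card_independent card_image)
  qed
  moreover have "dim ?X = n"
  proof -
    let ?g = "\<lambda>i. curl T (e i)"
    have I: "{1..n} = insert 1 {2..n}"
      using n by auto
    have curl_sum: "curl T (\<Sum>i\<in>I. c i *\<^sub>R e i) = (\<Sum>i\<in>I. c i *\<^sub>R ?g i)" if "I \<subseteq> {1..n}" for I c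
      using that eC1 by (intro linear_between_sum[OF lin]) (auto intro: finite_subset)
    \<comment> \<open>Applying the curl to the partition of unity gives a linear relation among the
      \<open>n\<close> curls, which makes \<open>?g 1\<close> redundant.\<close>
    have "(\<Sum>i=1..n. 1 *\<^sub>R ?g i) = curl T (on_set T (\<lambda>_. 1))"
      by (simp only: curl_sum[OF order_refl, symmetric] sum_e)
    also have "\<dots> = 0"
      using curl_eq_0_iff[OF T] const_funs_subset_C1_functions[OF T] by (auto simp: const_funs_def)
    finally have "?g 1 = - (\<Sum>i=2..n. ?g i)"
      by (simp only: I) (simp add: eq_neg_iff_add_eq_0)
    then have "?g 1 \<in> span (?g ` {2..n})"
      by (simp only:) (intro span_neg span_sum, intro span_base imageI)
    then have "?g 1 \<in> span (?g ` {2..n} \<union> {R})"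
      using span_mono[of "?g ` {2..n}" "?g ` {2..n} \<union> {R}"] by blast
    then have X: "?X = span (insert R (?g ` {2..n}))"
      by (simp only: X_span I image_insert Un_insert_left span_redundant) simp
    have zero: "c i = 0" if c: "(\<Sum>j=2..n. c j *\<^sub>R ?g j) = 0" and i: "i \<in> {2..n}" for c i
    proof -
      \<comment> \<open>Padding with coefficient 0 at index 1 yields a combination of all
        \<open>e j\<close>, whose coefficients are its values at the vertices. Being constant, it
        then equals its value 0 at \<open>v 1\<close>.\<close>
      let ?c = "\<lambda>i. if i = 1 then 0 else c i"
      let ?u = "\<Sum>j=1..n. ?c j *\<^sub>R e j"
      have "?u \<in> ?M"
        unfolding M by (intro span_sum span_scale span_base) auto
      moreover have "curl T ?u = 0"
      proof -
        have "curl T ?u = (\<Sum>j=1..n. ?c j *\<^sub>R ?g j)"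
          by (rule curl_sum) simp
        also have "\<dots> = (\<Sum>j=2..n. ?c j *\<^sub>R ?g j)"
          by (simp only: I) simp
        also have "\<dots> = (\<Sum>j=2..n. c j *\<^sub>R ?g j)"
          by (intro sum.cong) auto
        finally show ?thesis
          using c by simp
      qed
      ultimately have "?u \<in> const_funs T"
        using curl_eq_0_iff[OF T] MC1 by auto
      then obtain k where k: "?u = on_set T (\<lambda>_. k)"
        by (auto simp: const_funs_def)
      have "?c j = k" if "j \<in> {1..n}" for j
        using e_v[OF that, of ?c] vT[OF that] by (simp only: k) (simp add: on_set_def)
      from this[OF n] this[of i] i show ?thesis
        by auto
    qed
    have ind: "inj_on ?g {2..n}" "independent (?g ` {2..n})"
      by (rule linearly_independent_family[where e = ?g], simp, erule zero, assumption)+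
    \<comment> \<open>The divergence separates \<open>R\<close> from the curls: it is 2 on
      \<open>R\<close> and 0 on every curl.\<close>
    have "R \<notin> span (?g ` {2..n})"
    proof
      assume "R \<in> span (?g ` {2..n})"
      then have "R \<in> curl T ` ?M"
        unfolding curlM using span_mono[of "?g ` {2..n}" "?g ` {1..n}"] by (auto simp: image_mono)
      then have "weak_div T R = 0"
        using exact3 by (simp add: exact_at_def)
      moreover have "R = curl T 0 + 1 *\<^sub>R R"
        using linear_between_0[OF lin] by simp
      then have "weak_div T R = on_set T (\<lambda>_. 2)"
        using div(2)[OF subspace_0[OF subM], of 1] by simp
      ultimately show False
        using on_set_eq_0[of 2] by simp
    qed
    then have "independent (insert R (?g ` {2..n}))" "R \<notin> ?g ` {2..n}"
      using ind(2) by (auto simp: independent_insertI intro: span_base)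
    \<comment> \<open>There are \<open>n - 1\<close> curls besides \<open>R\<close>;
      \<open>n \<ge> 1\<close> makes the count add up to \<open>n\<close> despite truncated
      subtraction.\<close>
    then show ?thesis
      using n by (simp add: X dim_eq_card_independent card_image[OF ind(1)])
  qed
  ultimately show ?thesis
    by blast
qed

end
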